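(* Let $B_2$ be the second-order B-spline and let $\mathcal{F}(B_2)$ be its frame set. Then $$\mathcal{F}(B_2)\supset \Gamma_3\cup\Lambda,\qquad \Lambda:=\bigcup_{m=3}^{\infty}\Lambda_m,$$ where $$\Gamma_3:=\left\{(a,b)\in\mathbb{R}^2_+ : a\in\left(0,\tfrac{2}{9}\right]\cup\left(\tfrac{2}{7},\tfrac12\right),\ b\in\left(\tfrac{4}{2+3a},\tfrac{2}{1+a}\right]\right\},$$ $$\Lambda_3:=\left\{(a,b)\in\mathbb{R}^2_+ : a\in\left[\tfrac12,\tfrac45\right],\ b\in\left(\tfrac{4}{2+3a},\tfrac{6}{2+5a}\right],\ b>1\right\},$$ and for integers $m\ge 4$ $$\Lambda_m:=\left\{(a,b)\in\mathbb{R}^2_+ : a\in\left[\tfrac{m-3}{m-2},\tfrac{2(m-1)}{2m-1}\right],\ b\in\left(\tfrac{2(m-1)}{2+(2m-3)a},\ \min\left(\tfrac{2m}{2+(2m-1)a},\tfrac{2}{1+a}\right)\right],\ b>1\right\}.$$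
   Context: $\mathbb{R}^2_+$ denotes the set of pairs $(a,b)$ of real numbers with $a>0$ and $b>0$. The second-order B-spline is $B_2:\mathbb{R}\to\mathbb{R}$, $B_2(x)=1+x$ for $x\in[-1,0]$, $B_2(x)=1-x$ for $x\in[0,1]$, and $B_2(x)=0$ otherwise. For $g\in L^2(\mathbb{R})$ and $a,b>0$, the Gabor system is $\mathcal{G}(g,a,b)=\{M_{\ell b}T_{ka}g=e^{2\pi i\ell b\,\cdot}g(\cdot-ka):(\ell,k)\in\mathbb{Z}^2\}$. It is called a (Gabor) frame for $L^2(\mathbb{R})$ if there are constants $A,B>0$ such that $A\|f\|_2^2\le\sum_{\ell,k\in\mathbb{Z}}|\langle f,M_{\ell b}T_{ka}g\rangle|^2\le B\|f\|_2^2$ for all $f\in L^2(\mathbb{R})$. The frame set of $g$ is $\mathcal{F}(g)=\{(a,b)\in\mathbb{R}^2_+:\mathcal{G}(g,a,b)\text{ is a frame for }L^2(\mathbb{R})\}$. *)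

theory Defs
  imports "HOL-Analysis.Analysis"
begin

definition L2 :: "(real \<Rightarrow> complex) set" where
  "L2 = {f. f \<in> borel_measurable lebesgue \<and> integrable lebesgue (\<lambda>x. (cmod (f x))\<^sup>2)}"

definition L2_norm :: "(real \<Rightarrow> complex) \<Rightarrow> real" where
  "L2_norm f = sqrt (LINT x|lebesgue. (cmod (f x))\<^sup>2)"

definition L2_inner :: "(real \<Rightarrow> complex) \<Rightarrow> (real \<Rightarrow> complex) \<Rightarrow> complex" where
  "L2_inner f g = (LINT x|lebesgue. f x * cnj (g x))"

definition translation :: "real \<Rightarrow> (real \<Rightarrow> complex) \<Rightarrow> real \<Rightarrow> complex" where
  "translation c g = (\<lambda>x. g (x - c))"

definition modulation :: "real \<Rightarrow> (real \<Rightarrow> complex) \<Rightarrow> real \<Rightarrow> complex" where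
  "modulation c g = (\<lambda>x. exp (\<i> * complex_of_real (2 * pi * c * x)) * g x)"

definition gabor_system ::
  "(real \<Rightarrow> complex) \<Rightarrow> real \<Rightarrow> real \<Rightarrow> int \<times> int \<Rightarrow> real \<Rightarrow> complex" where
  "gabor_system g a b =
     (\<lambda>(l, k). modulation (of_int l * b) (translation (of_int k * a) g))"

(* A divergent infsum evaluates to 0, so the finiteness implied by the upper frame
   bound has to be stated as an explicit summability condition. *)
definition L2_frame :: "('i \<Rightarrow> real \<Rightarrow> complex) \<Rightarrow> bool" where
  "L2_frame \<phi> \<longleftrightarrow>
     (\<forall>i. \<phi> i \<in> L2) \<and>
     (\<exists>A B. A > 0 \<and> B > 0 \<and>
       (\<forall>f\<in>L2.
          (\<lambda>i. (cmod (L2_inner f (\<phi> i)))\<^sup>2) summable_on UNIV \<and>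
          A * (L2_norm f)\<^sup>2 \<le> (\<Sum>\<^sub>\<infinity>i. (cmod (L2_inner f (\<phi> i)))\<^sup>2) \<and>
          (\<Sum>\<^sub>\<infinity>i. (cmod (L2_inner f (\<phi> i)))\<^sup>2) \<le> B * (L2_norm f)\<^sup>2))"

definition frame_set :: "(real \<Rightarrow> complex) \<Rightarrow> (real \<times> real) set" where
  "frame_set g = {(a, b). a > 0 \<and> b > 0 \<and> L2_frame (gabor_system g a b)}"

definition B2 :: "real \<Rightarrow> real" where
  "B2 x = (if x \<in> {-1..0} then 1 + x else if x \<in> {0..1} then 1 - x else 0)"

definition Gamma3 :: "(real \<times> real) set" where
  "Gamma3 = {(a, b). a > 0 \<and> b > 0 \<and>
     a \<in> {0<..2/9} \<union> {2/7<..<1/2} \<and>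
     b \<in> {4 / (2 + 3 * a)<..2 / (1 + a)}}"

(* Only the indices m \<ge> 3 are used. *)
definition Lambda :: "nat \<Rightarrow> (real \<times> real) set" where
  "Lambda m =
     (if m = 3 then
        {(a, b). a > 0 \<and> b > 0 \<and>
           a \<in> {1/2..4/5} \<and>
           b \<in> {4 / (2 + 3 * a)<..6 / (2 + 5 * a)} \<and> b > 1}
      else
        {(a, b). a > 0 \<and> b > 0 \<and>
           a \<in> {(real m - 3) / (real m - 2)..2 * (real m - 1) / (2 * real m - 1)} \<and>
           b \<in> {2 * (real m - 1) / (2 + (2 * real m - 3) * a)<..
                 min (2 * real m / (2 + (2 * real m - 1) * a)) (2 / (1 + a))} \<and> b > 1})"

end

(* Write s = 1/b and let B be the hat function. For f in L^2 put
   F_k(y) = sum_n f(y + n s) B(y + n s - k a), which is s-periodic in y. By Parseval on one period,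
   sum_l |<f, M_{lb} T_{ka} B>|^2 = s * int_period |F_k|^2. The upper bound is immediate, and the
   lower bound follows once f(y) can be recovered, with uniform constants, from finitely many F_k(y).
   For y = k a + x, the values f(y - 2s), f(y - s), f(y), f(y + s) and the four sums
   F_{k+1}, F_k, F_{k-1}, F_{k-2} at y form a 4 x 4 linear system with piecewise linear coefficients
   in x; its kernel is trivial for x in a compact interval, so compactness gives the constants.
   If 2 (1 - s) <= a, that interval is [0, s - a] and the remaining x are reached by propagating along
   y - s, y - 2s, ...; otherwise the interval is already [0, a/2]. *)

theory Submission
  imports Defs
begin

subsection \<open>Kernel of the local linear system\<close>

text \<open>With \<open>s = 1 / b\<close> the bound \<open>b \<le> 2 / (1 + a)\<close> reads
  \<open>1 + a \<le> 2 * s\<close>. It keeps \<open>y + 2 * s\<close> outside all four hats, so that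
  four unknowns suffice. The two ranges differ in the outer sums. If
  \<open>2 * (1 - s) \<le> a\<close>, each outer sum involves only two unknowns wherever it is
  needed, and the system is symmetric under exchanging \<open>y\<close>, \<open>y + s\<close> with
  \<open>y - s\<close>, \<open>y - 2 * s\<close>; the outer unknowns are eliminated and a 2 x 2
  determinant decides. Otherwise the outer sums couple more unknowns and this elimination breaks
  down. There a kernel vector is normalised at \<open>y\<close>, and eliminating its entry at
  \<open>y - 2 * s\<close> leaves a sum of signed terms that cannot vanish; this is shown by
  separate estimates for \<open>a \<le> 2/9\<close> and \<open>a > 2/7\<close>. The lower bound on
  \<open>b\<close>, that is \<open>4 * s < 2 + 3 * a\<close>, ensures that the sum
  \<open>F_{k-2}\<close> sees \<open>y - 2 * s\<close>. Every \<open>Lambda m\<close> with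
  \<open>m \<ge> 3\<close> has \<open>a \<ge> 1/2\<close> and lies in the first range;
  \<open>Gamma3\<close> meets both.\<close>

lemma B2_eq: "B2 x = max 0 (1 - \<bar>x\<bar>)"
  by (auto simp: B2_def)

lemma two_by_two_kernel:
  fixes A B C D r q :: real
  assumes "A * r + B * q = 0" "C * q + D * r = 0" "A * C \<noteq> B * D"
  shows "r = 0" "q = 0"
proof -
  have "(A * C - B * D) * r = C * (A * r + B * q) - B * (C * q + D * r)" by algebra
  then show "r = 0" using assms by simp
  have "(A * C - B * D) * q = A * (C * q + D * r) - D * (A * r + B * q)" by algebra
  then show "q = 0" using assms by simp
qed

section \<open>The kernel in the range \<open>2 * (1 - s) \<le> a\<close>\<close>

text \<open>Diagonal dominance of the \<open>2 \<times> 2\<close> system in \<open>f y\<close> and \<open>f (y - s)\<close> that remains after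
  eliminating the two outer unknowns.\<close>

lemma eliminated_pivot_gt:
  fixes a \<sigma> w :: real
  assumes "0 \<le> w" "w < \<sigma>" "2 * \<sigma> \<le> a" "2 * \<sigma> \<le> 1 - a"
  shows "(\<sigma> + w) * (a + \<sigma> - w) < (1 - w) * (a + \<sigma> - w) - (\<sigma> - w) * (1 - a + w)"
proof -
  have s4: "\<sigma> \<le> 1/4" using assms by linarith
  have "0 \<le> (a - 2 * \<sigma>) * (1 - 3 * w)"
    using assms s4 by (intro mult_nonneg_nonneg) auto
  moreover have "0 < \<sigma> * (2 - 8 * w - \<sigma>) + 3 * w\<^sup>2"
  \<comment> \<open>The threshold \<open>7/32\<close> is where \<open>2 - 8 * w\<close> equals
    \<open>1/4\<close>, the upper bound of \<open>\<sigma>\<close>. Up to it the product is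
    nonnegative; beyond it the product is at least \<open>-1/16\<close>, which
    \<open>3 * w^2\<close> outweighs.\<close>
  proof (cases "w \<le> 7/32")
    case True
    show ?thesis
    proof (cases "w = 7/32")
      case True
      have "0 \<le> \<sigma> * (1/4 - \<sigma>)" using assms s4 by (intro mult_nonneg_nonneg) auto
      moreover have "\<sigma> * (2 - 8 * w - \<sigma>) = \<sigma> * (1/4 - \<sigma>)" using True by simp
      moreover have "0 < 3 * w\<^sup>2" using True by simp
      ultimately show ?thesis by linarith
    next
      case False
      then have "0 < \<sigma> * (2 - 8 * w - \<sigma>)" using True assms s4 by (intro mult_pos_pos) auto
      then show ?thesis by (simp add: add_pos_nonneg)
    qed
  next
    case False
    have "(1/4) * (-1/4) \<le> \<sigma> * (2 - 8 * w - \<sigma>)"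
    proof -
      have "\<sigma> * (-1/4) \<le> \<sigma> * (2 - 8 * w - \<sigma>)"
        using assms s4 by (intro mult_left_mono) auto
      then show ?thesis using s4 by simp
    qed
    moreover have "(7/32)\<^sup>2 \<le> w\<^sup>2" using False by (intro power_mono) auto
    ultimately show ?thesis by (simp add: power2_eq_square)
  qed
  moreover have "(1 - w) * (a + \<sigma> - w) - (\<sigma> - w) * (1 - a + w) - (\<sigma> + w) * (a + \<sigma> - w)
     = (a - 2 * \<sigma>) * (1 - 3 * w) + (\<sigma> * (2 - 8 * w - \<sigma>) + 3 * w\<^sup>2)"
    by algebra
  ultimately show ?thesis by linarith
qed

text \<open>The mixed case: the outer unknown on the side of \<open>u\<close> has dropped out, so
  only \<open>z\<close> is eliminated. The row \<open>e2\<close> need not be diagonally dominant, so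
  the determinant is computed exactly and written as a sum of visibly signed terms.\<close>

lemma block_kernel_mixed:
  fixes a \<sigma> w u r q z :: real
  assumes "0 \<le> w" "w < \<sigma>" "2 * \<sigma> \<le> a" "2 * \<sigma> \<le> 1 - a" "u = 1 - \<sigma> - a - w"
    and e0: "(\<sigma> - w) * z + (1 - w) * r + (\<sigma> + w) * q = 0"
    and e1: "(a + \<sigma> - w) * z + (1 - a + w) * r = 0"
    and e2: "(1 - u) * q + (\<sigma> + u) * r = 0"
  shows "r = 0 \<and> q = 0"
proof -
  let ?L = "a + \<sigma> - w"
  let ?P = "(1 - w) * ?L - (\<sigma> - w) * (1 - a + w)"
  have m: "3 * \<sigma> \<le> a + \<sigma>" and s0: "0 < \<sigma>" using assms by auto
  \<comment> \<open>Cross-multiplication of \<open>e0\<close> and \<open>e1\<close> eliminates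
    \<open>z\<close> without a division.\<close>
  have "?P * r + ((\<sigma> + w) * ?L) * q = ?L * ((\<sigma> - w) * z + (1 - w) * r + (\<sigma> + w) * q)
      - (\<sigma> - w) * (?L * z + (1 - a + w) * r)"
    by algebra
  then have E: "?P * r + ((\<sigma> + w) * ?L) * q = 0" using e0 e1 by simp
  have "?P * (1 - u) - ((\<sigma> + w) * ?L) * (\<sigma> + u)
     = (a + \<sigma>) * ((1 - w) * (a + \<sigma>) - 2 * (1 - a) * \<sigma>) + w\<^sup>2 * (1 + w)"
    unfolding assms(5) by algebra
  moreover have "0 < (a + \<sigma>) * ((1 - w) * (a + \<sigma>) - 2 * (1 - a) * \<sigma>)"
  proof (rule mult_pos_pos)
    have "(1 - w) * (3 * \<sigma>) \<le> (1 - w) * (a + \<sigma>)"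
      using assms m by (intro mult_left_mono) auto
    moreover have "0 < \<sigma> * (1 - 3 * w + 2 * a)"
      using assms s0 by (intro mult_pos_pos) auto
    moreover have "(1 - w) * (3 * \<sigma>) - 2 * (1 - a) * \<sigma> = \<sigma> * (1 - 3 * w + 2 * a)" by algebra
    ultimately show "0 < (1 - w) * (a + \<sigma>) - 2 * (1 - a) * \<sigma>" by linarith
  qed (use assms in auto)
  moreover have "0 \<le> w\<^sup>2 * (1 + w)" using assms by simp
  ultimately have "?P * (1 - u) \<noteq> ((\<sigma> + w) * ?L) * (\<sigma> + u)" by linarith
  then show ?thesis using two_by_two_kernel[OF E e2] by auto
qed

text \<open>In the application \<open>\<sigma> = 1 - s\<close>, and \<open>w\<close>,
  \<open>u\<close> are the distances of \<open>y\<close> and \<open>y - s\<close> from the nearby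
  centres \<open>k * a\<close> and \<open>(k - 1) * a\<close>. An outer unknown enters its central
  row only if the corresponding distance is below \<open>\<sigma>\<close>, and exactly then an outer
  row is available to remove it. With both removed, the two dominances multiply; with none present,
  the determinant is \<open>(1 + \<sigma>) * a\<close>.\<close>

lemma block_kernel:
  fixes a \<sigma> w u p q r z :: real
  assumes "0 < \<sigma>" "2 * \<sigma> \<le> a" "2 * \<sigma> \<le> 1 - a" "0 \<le> w" "0 \<le> u" "u + w = 1 - \<sigma> - a"
    and w0: "max 0 (\<sigma> - w) * z + (1 - w) * r + (\<sigma> + w) * q = 0"
    and u0: "max 0 (\<sigma> - u) * p + (1 - u) * q + (\<sigma> + u) * r = 0"
    and w1: "w < \<sigma> \<Longrightarrow> (a + \<sigma> - w) * z + (1 - a + w) * r = 0"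
    and u1: "u < \<sigma> \<Longrightarrow> (a + \<sigma> - u) * p + (1 - a + u) * q = 0"
  shows "r = 0 \<and> q = 0"
proof -
  consider (both) "w < \<sigma>" "u < \<sigma>" | (w) "w < \<sigma>" "\<sigma> \<le> u" | (u) "\<sigma> \<le> w" "u < \<sigma>" | (none) "\<sigma> \<le> w" "\<sigma> \<le> u"
    by linarith
  then show ?thesis
  proof cases
    case both
    let ?Lw = "a + \<sigma> - w" and ?Lu = "a + \<sigma> - u"
    let ?Pw = "(1 - w) * ?Lw - (\<sigma> - w) * (1 - a + w)"
    let ?Pu = "(1 - u) * ?Lu - (\<sigma> - u) * (1 - a + u)"
    have gw: "(\<sigma> + w) * ?Lw < ?Pw" and gu: "(\<sigma> + u) * ?Lu < ?Pu"
      using eliminated_pivot_gt both assms by auto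
    have "?Pw * r + ((\<sigma> + w) * ?Lw) * q = ?Lw * ((\<sigma> - w) * z + (1 - w) * r + (\<sigma> + w) * q)
      - (\<sigma> - w) * (?Lw * z + (1 - a + w) * r)" by algebra
    then have E: "?Pw * r + ((\<sigma> + w) * ?Lw) * q = 0" using w0 w1 both by simp
    have "?Pu * q + ((\<sigma> + u) * ?Lu) * r = ?Lu * ((\<sigma> - u) * p + (1 - u) * q + (\<sigma> + u) * r)
      - (\<sigma> - u) * (?Lu * p + (1 - a + u) * q)" by algebra
    then have F: "?Pu * q + ((\<sigma> + u) * ?Lu) * r = 0" using u0 u1 both by simp
    have "0 \<le> (\<sigma> + w) * ?Lw" "0 \<le> (\<sigma> + u) * ?Lu" using both assms by auto
    then have "((\<sigma> + w) * ?Lw) * ((\<sigma> + u) * ?Lu) < ?Pw * ?Pu"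
      using gw gu by (intro mult_strict_mono') auto
    then show ?thesis using two_by_two_kernel[OF E F] by auto
  next
    case w
    then show ?thesis using block_kernel_mixed[of w \<sigma> a u z r q] assms by auto
  next
    case u
    then show ?thesis using block_kernel_mixed[of u \<sigma> a w p q r] assms by auto
  next
    case none
    have E: "(1 - w) * r + (\<sigma> + w) * q = 0" and F: "(1 - u) * q + (\<sigma> + u) * r = 0"
      using none w0 u0 by auto
    have "u = 1 - \<sigma> - a - w" using assms by linarith
    then have "(1 - w) * (1 - u) - (\<sigma> + w) * (\<sigma> + u) = (1 + \<sigma>) * a"
      by algebra
    moreover have "0 < (1 + \<sigma>) * a" using assms by simp
    ultimately show ?thesis using two_by_two_kernel[OF E F] by auto
  qed
qed

text \<open>The coordinates stand for \<open>f (y - 2 * s)\<close>, \<open>f (y - s)\<close>, \<open>f y\<close>, \<open>f (y + s)\<close>, and \<open>t = y - k * a\<close>.\<close>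

definition row :: "real \<Rightarrow> real \<times> real \<times> real \<times> real \<Rightarrow> real \<Rightarrow> real" where
  "row s = (\<lambda>(p, q, r, z) t. p * B2 (t - 2 * s) + q * B2 (t - s) + r * B2 t + z * B2 (t + s))"

definition rows_zero :: "real \<Rightarrow> real \<Rightarrow> real \<Rightarrow> real \<times> real \<times> real \<times> real \<Rightarrow> bool" where
  "rows_zero s a x v \<longleftrightarrow>
     row s v (x - a) = 0 \<and> row s v x = 0 \<and> row s v (x + a) = 0 \<and> row s v (x + 2 * a) = 0"

lemma rows_kernel_near:
  fixes a s x :: real
  assumes s: "s < 1" "2 * (1 - s) \<le> a" "1 + a \<le> 2 * s" and d: "s - a < 1/2"
    and x: "0 \<le> x" "x \<le> s - a" and z: "rows_zero s a x (p, q, r, z)"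
  shows "p = 0 \<and> q = 0 \<and> r = 0 \<and> z = 0"
proof -
  note rows = z[unfolded rows_zero_def row_def split_conv]
  \<comment> \<open>The point \<open>y\<close> lies \<open>x\<close> to the right of
    \<open>k * a\<close>, and \<open>y - s\<close> lies \<open>u\<close> to the left of
    \<open>(k - 1) * a\<close>. Exchanging \<open>x\<close> and \<open>u\<close> reflects the system
    onto itself.\<close>
  define u where "u = s - a - x"
  have v0: "B2 (x - 2 * s) = 0" "B2 (x - s) = 1 - s + x" "B2 x = 1 - x"
    "B2 (x + s) = max 0 (1 - s - x)"
    using s x by (auto simp: B2_eq)
  have v1: "B2 (x + a - 2 * s) = max 0 (1 - s - u)" "B2 (x + a - s) = 1 - u"
    "B2 (x + a) = 1 - s + u" "B2 (x + a + s) = 0"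
    using s x by (auto simp: B2_eq u_def max_def)
  have v2: "B2 (x - a - 2 * s) = 0" "B2 (x - a + s) = a + (1 - s) - x"
    "B2 (x + 2 * a - 2 * s) = a + (1 - s) - u" "B2 (x + 2 * a + s) = 0"
    using s x d by (auto simp: B2_eq u_def)
  \<comment> \<open>Here \<open>2 * (1 - s) \<le> a\<close> enters: with \<open>x < 1 - s\<close> it
    gives \<open>x \<le> a - (1 - s)\<close>, so \<open>y - s\<close> is outside the hat centred at
    \<open>(k + 1) * a\<close> and only \<open>z\<close> and \<open>r\<close> remain.\<close>
  have R1: "(a + (1 - s) - x) * z + (1 - a + x) * r = 0" if "x < 1 - s"
  proof -
    have "B2 (x - a - s) = 0" "B2 (x - a) = 1 - a + x"
      using s x that by (auto simp: B2_eq)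
    then show ?thesis using rows v2 by (simp add: mult.commute add.commute)
  qed
  have R2: "(a + (1 - s) - u) * p + (1 - a + u) * q = 0" if "u < 1 - s"
  proof -
    have "B2 (x + 2 * a) = 0" "B2 (x + 2 * a - s) = 1 - a + u"
      using s x that by (auto simp: B2_eq u_def)
    then show ?thesis using rows v2 by (simp add: mult.commute)
  qed
  have rq: "r = 0 \<and> q = 0"
  proof (rule block_kernel)
    show "max 0 (1 - s - x) * z + (1 - x) * r + (1 - s + x) * q = 0"
      using rows v0 by (simp add: mult.commute)
    show "max 0 (1 - s - u) * p + (1 - u) * q + (1 - s + u) * r = 0"
      using rows v1 by (simp add: mult.commute)
  qed (use R1 R2 s x in \<open>auto simp: u_def\<close>)
  \<comment> \<open>Since \<open>s - a < 1/2\<close>, these coefficients of \<open>z\<close> and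
    \<open>p\<close> in the outer rows are positive; once \<open>r\<close> and \<open>q\<close>
    vanish, so do \<open>z\<close> and \<open>p\<close>.\<close>
  moreover have "a + (1 - s) - x > 0" "a + (1 - s) - u > 0" using s x d by (auto simp: u_def)
  ultimately show ?thesis using rows v2 by simp
qed

section \<open>The kernel in the range \<open>a < 2 * (1 - s)\<close>\<close>

text \<open>With the middle unknown normalised to \<open>r = 1\<close>, the signs \<open>q < 0\<close> and \<open>z < 0\<close>
  are forced by two rows, and the other two rows then contradict each other.\<close>

lemma far_signs:
  fixes a \<sigma> x \<alpha> q z :: real
  assumes a: "0 < a" "a < 1/2" and x: "0 \<le> x" "2 * x \<le> a" "x < \<sigma>" and \<sigma>: "2 * \<sigma> \<le> 1 - a"
    and \<alpha>: "\<alpha> = max 0 (a - x - \<sigma>)"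
    and e0: "(\<sigma> - x) * z + (1 - x) + (\<sigma> + x) * q = 0"
    and e1: "a * (z - q) = a - 2 * x - \<alpha> * q"
  shows "q < 0" "z < 0" "2 * \<sigma> * (- z) \<le> 1 - x"
proof -
  have \<alpha>0: "0 \<le> \<alpha>" "\<alpha> \<le> a" using assms by auto
  have E: "2 * \<sigma> * q + (z - q) * (\<sigma> - x) + 1 - x = 0" using e0 by algebra
  show q: "q < 0"
  proof (rule ccontr)
    assume "\<not> q < 0"
    then have q0: "0 \<le> q" by simp
    have "\<alpha> * q \<le> a * q" using \<alpha>0 q0 by (intro mult_right_mono)
    then have "0 \<le> a * z" using e1 x by (simp add: algebra_simps)
    then have "0 \<le> z" using a by (simp add: zero_le_mult_iff)
    then have "0 \<le> (\<sigma> - x) * z" using x by simp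
    moreover have "0 \<le> (\<sigma> + x) * q" using q0 x by simp
    ultimately show False using e0 x a by linarith
  qed
  have az: "a * z = a - 2 * x - (a - \<alpha>) * (- q)" using e1 by algebra
  show z: "z < 0"
  proof (rule ccontr)
    assume "\<not> z < 0"
    then have z0: "0 \<le> z" by simp
    have "0 \<le> a * z" using z0 a by simp
    then have 1: "(a - \<alpha>) * (- q) \<le> a - 2 * x" using az by linarith
    have 2: "1 - x \<le> (\<sigma> + x) * (- q)"
    proof -
      have "0 \<le> (\<sigma> - x) * z" using x z0 by simp
      then show ?thesis using e0 by linarith
    qed
    have "(a - \<alpha>) * (1 - x) \<le> (a - \<alpha>) * ((\<sigma> + x) * (- q))"
      using 2 \<alpha>0 by (intro mult_left_mono) auto
    also have "\<dots> = (\<sigma> + x) * ((a - \<alpha>) * (- q))" by algebra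
    also have "\<dots> \<le> (\<sigma> + x) * (a - 2 * x)" using 1 x by (intro mult_left_mono) auto
    finally have 3: "(a - \<alpha>) * (1 - x) \<le> (\<sigma> + x) * (a - 2 * x)" .
    show False
    proof (cases "a - x - \<sigma> \<le> 0")
      case True
      then have "a * (1 - x) \<le> (\<sigma> + x) * (a - 2 * x)" using 3 \<alpha> by simp
      also have "\<dots> \<le> (\<sigma> + x) * a" using x by (intro mult_left_mono) auto
      finally have "1 - x \<le> \<sigma> + x" using a by (simp add: mult.commute)
      then show False using x \<sigma> a by linarith
    next
      case False
      then have "(\<sigma> + x) * (1 - x) \<le> (\<sigma> + x) * (a - 2 * x)" using 3 \<alpha> by (simp add: add.commute)
      then have "1 - x \<le> a - 2 * x" using x by simp
      then show False using x a by linarith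
    qed
  qed
  \<comment> \<open>\<open>e0\<close> says
    \<open>(\<sigma> - x) * (- z) + (\<sigma> + x) * (- q) = 1 - x\<close>. Replacing
    \<open>- q\<close> by the smaller \<open>- z\<close> merges both terms into
    \<open>2 * \<sigma> * (- z)\<close>.\<close>
  have "a * (- z) \<le> a * (- q)"
  proof -
    have "(a - \<alpha>) * (- q) \<le> a * (- q)" using \<alpha>0 q by (intro mult_right_mono) auto
    then show ?thesis using az x by linarith
  qed
  then have "(\<sigma> + x) * (- z) \<le> (\<sigma> + x) * (- q)" using a x by (intro mult_left_mono) auto
  then show "2 * \<sigma> * (- z) \<le> 1 - x" using e0 by (simp add: algebra_simps)
qed

text \<open>Eliminating \<open>p\<close> from the rows of \<open>F_{k-1}\<close> and
  \<open>F_{k-2}\<close> gives an identity that this strict inequality contradicts. The value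
  \<open>a * (a / 2)\<close> separates the two sides: \<open>D + 1 \<ge> 1\<close> and
  \<open>a - e \<ge> a / 2\<close> on the right, and the bound
  \<open>e - \<beta> \<le> 3 * \<sigma> - 1\<close> on the left.\<close>

lemma far_contradiction_large:
  fixes a \<sigma> x \<beta> \<beta>2 e z D :: real
  assumes a: "2/7 < a" "a < 1/2" and x: "0 \<le> x" "2 * x \<le> a" and \<sigma>: "2 * \<sigma> \<le> 1 - a"
    and e: "e = 2 * \<sigma> - 1 + a + x" "0 < e"
    and \<beta>: "\<beta> = max 0 (a + x - \<sigma>)" "\<beta>2 = max 0 (2 * a + x - \<sigma>)"
    and D: "a - 2 * x \<le> a * D" and z: "z < 0" "2 * \<sigma> * (- z) \<le> 1 - x"
  shows "(- z) * (e * \<beta>2 - (e + a) * \<beta>) < a * (D + 1) * (a - e)"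
proof -
  have aD: "a \<le> a * (D + 1)" using D x by (simp add: algebra_simps)
  have ae: "a / 2 \<le> a - e" using e x \<sigma> by linarith
  have "a * (a / 2) \<le> a * (D + 1) * (a - e)"
    using aD ae a by (intro mult_mono) auto
  moreover have "(- z) * (e * \<beta>2 - (e + a) * \<beta>) < a * (a / 2)"
  proof -
    have "e * \<beta>2 \<le> e * (a + \<beta>)" using e a \<beta> by (intro mult_left_mono) auto
    then have "e * \<beta>2 - (e + a) * \<beta> \<le> a * (e - \<beta>)" by (simp add: algebra_simps)
    also have "\<dots> \<le> a * (3 * \<sigma> - 1)" using e \<beta> a by (intro mult_left_mono) auto
    finally have c: "e * \<beta>2 - (e + a) * \<beta> \<le> a * (3 * \<sigma> - 1)" .
    have "(- z) * (e * \<beta>2 - (e + a) * \<beta>) \<le> (- z) * (a * (3 * \<sigma> - 1))"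
      using c z by (intro mult_left_mono) auto
    also have "\<dots> < a * (a / 2)"
    proof (cases "\<sigma> \<le> 1/3")
      case True
      then have "(- z) * (a * (3 * \<sigma> - 1)) \<le> 0"
        using z a by (intro mult_nonneg_nonpos) auto
      also have "0 < a * (a / 2)" using a by simp
      finally show ?thesis .
    next
      case False
      have "(2/3) * (- z) \<le> 2 * \<sigma> * (- z)" using False z by (intro mult_right_mono) auto
      then have "- z \<le> 3/2" using z x by linarith
      \<comment> \<open>From \<open>a > 2/7\<close> follows
        \<open>3 * \<sigma> - 1 \<le> (1 - 3 * a) / 2 < 1/14\<close>.\<close>
      then have "(- z) * (3 * \<sigma> - 1) \<le> (3/2) * (1/14)"
        using False \<sigma> a by (intro mult_mono) auto
      then have "(- z) * (3 * \<sigma> - 1) < a / 2" using a by linarith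
      then have "a * ((- z) * (3 * \<sigma> - 1)) < a * (a / 2)" using a by (intro mult_strict_left_mono) auto
      then show ?thesis by (simp add: mult_ac)
    qed
    finally show ?thesis .
  qed
  ultimately show ?thesis by linarith
qed

text \<open>The same separating value \<open>a * (a / 2)\<close> is reached as
  \<open>4/3 * 3/8 * a^2\<close>: for \<open>a \<le> 2/9\<close> the correction
  \<open>\<beta>\<close> vanishes, \<open>- z < 4/3\<close>, and \<open>e * \<beta>2\<close> is at
  most \<open>3/8 * a^2\<close>.\<close>

lemma far_contradiction_small:
  fixes a \<sigma> x \<beta> \<beta>2 e z D :: real
  assumes a: "0 < a" "a \<le> 2/9" and x: "0 \<le> x" "2 * x \<le> a"
    and \<sigma>: "2 * \<sigma> \<le> 1 - a" "1 - 3/2 * a < 2 * \<sigma>"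
    and e: "e = 2 * \<sigma> - 1 + a + x" "0 < e"
    and \<beta>: "\<beta> = max 0 (a + x - \<sigma>)" "\<beta>2 = max 0 (2 * a + x - \<sigma>)"
    and D: "a * D = a - 2 * x" and z: "z < 0" "2 * \<sigma> * (- z) = 1 - x - D * (\<sigma> + x)"
  shows "(- z) * (e * \<beta>2 - (e + a) * \<beta>) < a * (D + 1) * (a - e)"
proof -
  have \<beta>0: "\<beta> = 0" using \<beta> x a \<sigma> by auto
  have x0: "0 < x" and ex: "e \<le> x" using e \<sigma> by auto
  have s3: "1/3 < \<sigma>" using a \<sigma> by linarith
  have D0: "0 \<le> D" using D x a by (metis diff_ge_0_iff_ge zero_le_mult_iff not_le)
  have D1: "D = 1 - 2 * (x / a)" using D a by (simp add: field_simps)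
  define X where "X = x / a"
  have X: "0 < X" "X \<le> 1/2" "x = a * X" "D = 1 - 2 * X" using x0 x a D1 by (auto simp: X_def field_simps)
  have zb: "- z < 4/3"
  proof -
    \<comment> \<open>There is equality at \<open>X = 1/2\<close>, so \<open>2/9\<close> is the
      largest slope for which this bound covers all \<open>X \<le> 1/2\<close>.\<close>
    have "2/9 * (2 - X) \<le> 1/3 + (1 - 2 * X) * (1/3)" using X(2) by (simp add: field_simps)
    moreover have "a * (2 - X) \<le> 2/9 * (2 - X)" using a X by (intro mult_right_mono) auto
    ultimately have "a * (2 - X) \<le> 1/3 + (1 - 2 * X) * (1/3)" by linarith
    then have "1 - x \<le> 4/3 - 2 * a + D * (1/3)" unfolding X(3,4) by (simp add: algebra_simps)
    also have "\<dots> < 2 * \<sigma> * (4/3) + D * (1/3)" using \<sigma> by linarith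
    also have "\<dots> \<le> 2 * \<sigma> * (4/3) + D * (\<sigma> + x)"
      using D0 s3 x by (intro add_left_mono mult_left_mono) auto
    finally have "2 * \<sigma> * (- z) < 2 * \<sigma> * (4/3)" using z by linarith
    then show ?thesis using s3 mult_less_cancel_left_pos[of "2 * \<sigma>" "- z" "4/3"] by linarith
  qed
  define \<eta> where "\<eta> = (1 - a - 2 * \<sigma>) / a"
  have \<eta>: "0 \<le> \<eta>" "1 - a - 2 * \<sigma> = a * \<eta>" using \<sigma> a by (auto simp: \<eta>_def)
  have E: "e = a * (X - \<eta>)" unfolding e X(3) using \<eta>(2) by (simp add: algebra_simps)
  \<comment> \<open>Substituting \<open>\<sigma> = (1 - a - a * \<eta>) / 2\<close> gives
    \<open>a * (5/2 + X + \<eta> / 2) - 1/2\<close>, and \<open>a \<le> 2/9\<close> means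
    \<open>1/2 \<ge> 9/4 * a\<close>; this leaves the constant \<open>1/4\<close>.\<close>
  have "\<beta>2 \<le> a * (1/4 + X + \<eta> / 2)"
  proof -
    have "0 \<le> a * (1/4 + X + \<eta> / 2)" using a X \<eta> by simp
    moreover have "2 * a + x - \<sigma> \<le> a * (1/4 + X + \<eta> / 2)"
      using a \<eta> X(3) by (simp add: algebra_simps)
    ultimately show ?thesis using \<beta> by simp
  qed
  then have "e * \<beta>2 \<le> e * (a * (1/4 + X + \<eta> / 2))" using e by (intro mult_left_mono) auto
  \<comment> \<open>The parameter \<open>\<eta>\<close> lowers \<open>e\<close> by more than it can
    raise the bound on \<open>\<beta>2\<close>, so it may be discarded.\<close>
  also have "\<dots> = a\<^sup>2 * (X * (1/4 + X)) - a\<^sup>2 * (\<eta> * (1/4 + X / 2 + \<eta> / 2))"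
    unfolding E by (simp add: field_simps power2_eq_square)
  also have "\<dots> \<le> a\<^sup>2 * (X * (1/4 + X))" using X \<eta> by simp
  also have "\<dots> \<le> a\<^sup>2 * (1/2 * (1/4 + 1/2))"
    using X by (intro mult_left_mono mult_mono) auto
  finally have "e * \<beta>2 \<le> a\<^sup>2 * (3/8)" by simp
  then have "(- z) * (e * \<beta>2) \<le> (- z) * (a\<^sup>2 * (3/8))" using z by (intro mult_left_mono) auto
  also have "\<dots> < 4/3 * (a\<^sup>2 * (3/8))" using zb a by (intro mult_strict_right_mono) auto
  also have "\<dots> = a * (a / 2)" by (simp add: power2_eq_square)
  also have "\<dots> \<le> a * (D + 1) * (a - e)"
    using D0 ex x a by (intro mult_mono) (auto simp: algebra_simps)
  finally show ?thesis using \<beta>0 by simp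
qed

lemma rows_kernel_far_normalized:
  fixes a s x :: real
  assumes a: "0 < a" "a < 1/2" "a \<le> 2/9 \<or> 2/7 < a"
    and s: "1 + a \<le> 2 * s" "4 * s < 2 + 3 * a" "a < 2 * (1 - s)"
    and x: "0 \<le> x" "2 * x \<le> a"
  shows "\<not> rows_zero s a x (p, q, 1, z)"
proof
  assume "rows_zero s a x (p, q, 1, z)"
  note rows = this[unfolded rows_zero_def row_def split_conv]
  define \<sigma> where "\<sigma> = 1 - s"
  \<comment> \<open>On the linear branch that each hat value is compared with, it is affine in
    \<open>x\<close>. The quantities \<open>\<alpha>\<close>, \<open>\<beta>\<close>,
    \<open>\<beta>2\<close>, \<open>\<delta>\<close> correct for truncation at zero, while
    \<open>\<gamma>\<close> records crossing the apex, where the slope jumps by two; hence the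
    factor in \<open>- 2 * \<gamma>\<close>.\<close>
  define \<alpha> where "\<alpha> = max 0 (a - x - \<sigma>)"
  define \<beta> where "\<beta> = max 0 (a + x - \<sigma>)"
  define \<beta>2 where "\<beta>2 = max 0 (2 * a + x - \<sigma>)"
  define e where "e = 2 * \<sigma> - 1 + a + x"
  define \<gamma> where "\<gamma> = max 0 (2 * a + x - s)"
  define \<delta> where "\<delta> = max 0 (2 * a + x - 1)"
  define D where "D = z - q"
  note defs = \<sigma>_def \<alpha>_def \<beta>_def \<beta>2_def e_def \<gamma>_def \<delta>_def
  have \<sigma>: "2 * \<sigma> \<le> 1 - a" "1 - 3/2 * a < 2 * \<sigma>" "x < \<sigma>" using s x by (auto simp: \<sigma>_def)
  have v1: "B2 (x - a - 2 * s) = 0" "B2 (x - a - s) = \<sigma> - a + x + \<alpha>" "B2 (x - a) = 1 - a + x"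
    "B2 (x - a + s) = \<sigma> + a - x"
    using a s x unfolding B2_eq defs by (simp_all add: max_def abs_if)
  have v0: "B2 (x - 2 * s) = 0" "B2 (x - s) = \<sigma> + x" "B2 x = 1 - x" "B2 (x + s) = \<sigma> - x"
    using a s x unfolding B2_eq defs by (simp_all add: max_def abs_if)
  have v2: "B2 (x + a - 2 * s) = max 0 e" "B2 (x + a - s) = \<sigma> + a + x" "B2 (x + a) = 1 - a - x"
    "B2 (x + a + s) = \<sigma> - a - x + \<beta>"
    using a s x unfolding B2_eq defs by (simp_all add: max_def abs_if)
  have v3: "B2 (x + 2 * a - 2 * s) = e + a" "B2 (x + 2 * a - s) = \<sigma> + 2 * a + x - 2 * \<gamma>"
    "B2 (x + 2 * a) = 1 - 2 * a - x + \<delta>" "B2 (x + 2 * a + s) = \<sigma> - 2 * a - x + \<beta>2"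
    using a s x unfolding B2_eq defs by (simp_all add: max_def abs_if)
  have E0: "(\<sigma> - x) * z + (1 - x) + (\<sigma> + x) * q = 0"
    using rows unfolding v0 by (simp add: mult.commute)
  have E1: "(\<sigma> + a - x) * z + (1 - a + x) + (\<sigma> - a + x + \<alpha>) * q = 0"
    using rows unfolding v1 by (simp add: mult.commute)
  have E2: "(\<sigma> - a - x + \<beta>) * z + (1 - a - x) + (\<sigma> + a + x) * q + max 0 e * p = 0"
    using rows unfolding v2 by (simp add: mult.commute)
  have E3: "(\<sigma> - 2 * a - x + \<beta>2) * z + (1 - 2 * a - x + \<delta>) + (\<sigma> + 2 * a + x - 2 * \<gamma>) * q + (e + a) * p = 0"
    using rows unfolding v3 by (simp add: mult.commute)
  \<comment> \<open>Subtracting the central row leaves only \<open>D\<close> and the correction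
    terms, because shifting a centre by \<open>a\<close> changes each uncorrected hat value by
    \<open>a\<close> up to sign.\<close>
  have F1: "a * D = a - 2 * x - \<alpha> * q" unfolding D_def using E0 E1 by algebra
  have F2: "a * (D + 1) = \<beta> * z + max 0 e * p" unfolding D_def using E0 E2 by algebra
  have F3: "2 * a * (D + 1) = \<beta>2 * z + \<delta> - 2 * \<gamma> * q + (e + a) * p" unfolding D_def using E0 E3 by algebra
  have q: "q < 0" and z: "z < 0" and zb: "2 * \<sigma> * (- z) \<le> 1 - x"
    using far_signs[OF a(1,2) x \<sigma>(3,1) \<alpha>_def E0 F1[unfolded D_def]] by auto
  have "0 \<le> \<alpha> * (- q)" using q by (simp add: \<alpha>_def mult_nonneg_nonpos)
  then have Dlb: "a - 2 * x \<le> a * D" using F1 by linarith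
  then have "0 < a * (D + 1)" using x a by (simp add: algebra_simps)
  moreover have "\<beta> * z \<le> 0" using z by (simp add: \<beta>_def mult_nonneg_nonpos)
  ultimately have "0 < max 0 e * p" using F2 by linarith
  \<comment> \<open>The left side of \<open>F2\<close> is positive and \<open>\<beta> * z\<close> is
    not, so the entry \<open>p\<close> must contribute: \<open>y - 2 * s\<close> lies inside the hat
    of \<open>F_{k-1}\<close>.\<close>
  then have e0: "0 < e" by (cases "e \<le> 0") auto
  then have F2': "a * (D + 1) = \<beta> * z + e * p" using F2 by simp
  \<comment> \<open>This is \<open>e\<close> times \<open>F3\<close> minus \<open>e + a\<close>
    times \<open>F2'\<close>, in which \<open>p\<close> cancels.\<close>
  have "a * (D + 1) * (a - e) + z * (e * \<beta>2 - (e + a) * \<beta>) + e * \<delta> + 2 * \<gamma> * e * (- q) = 0"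
    using F2' F3 by algebra
  moreover have "0 \<le> e * \<delta>" "0 \<le> 2 * \<gamma> * e * (- q)" using e0 q by (auto simp: \<delta>_def \<gamma>_def mult_nonneg_nonpos)
  moreover have "(- z) * (e * \<beta>2 - (e + a) * \<beta>) < a * (D + 1) * (a - e)"
  proof (cases "2/7 < a")
    case True
    then show ?thesis
      using far_contradiction_large[OF True a(2) x \<sigma>(1) e_def e0 \<beta>_def \<beta>2_def Dlb z zb] by simp
  next
    case False
    then have a': "a \<le> 2/9" using a by auto
    then have "\<alpha> = 0" using \<sigma> x a by (simp add: \<alpha>_def)
    then have D': "a * D = a - 2 * x" using F1 by simp
    have z': "2 * \<sigma> * (- z) = 1 - x - D * (\<sigma> + x)" unfolding D_def using E0 by algebra
    show ?thesis
      using far_contradiction_small[OF a(1) a' x \<sigma>(1,2) e_def e0 \<beta>_def \<beta>2_def D' z z'] .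
  qed
  ultimately show False by (simp add: algebra_simps)
qed

lemma rows_zero_scale:
  assumes "rows_zero s a x (p, q, r, z)"
  shows "rows_zero s a x (c * p, c * q, c * r, c * z)"
proof -
  have "row s (c * p, c * q, c * r, c * z) t = c * row s (p, q, r, z) t" for t
    by (simp add: row_def algebra_simps)
  then show ?thesis using assms by (simp add: rows_zero_def)
qed

text \<open>Scaling reduces \<open>r \<noteq> 0\<close> to the normalised case. For
  \<open>r = 0\<close> the rows of \<open>F_k\<close> and \<open>F_{k+1}\<close> contain only
  \<open>q\<close> and \<open>z\<close>, and the row of \<open>F_{k-2}\<close> then determines
  \<open>p\<close>.\<close>

lemma rows_kernel_far:
  fixes a s x :: real
  assumes a: "0 < a" "a < 1/2" "a \<le> 2/9 \<or> 2/7 < a"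
    and s: "1 + a \<le> 2 * s" "4 * s < 2 + 3 * a" "a < 2 * (1 - s)"
    and x: "0 \<le> x" "2 * x \<le> a" and zero: "rows_zero s a x (p, q, r, z)"
  shows "p = 0 \<and> q = 0 \<and> r = 0 \<and> z = 0"
proof -
  have r: "r = 0"
  proof (rule ccontr)
    assume "r \<noteq> 0"
    then show False
      using rows_zero_scale[OF zero, of "1 / r"] rows_kernel_far_normalized[OF a s x] by simp
  qed
  define \<sigma> where "\<sigma> = 1 - s"
  define \<alpha> where "\<alpha> = max 0 (a - x - \<sigma>)"
  have \<sigma>: "x < \<sigma>" using s x by (auto simp: \<sigma>_def)
  note rows = zero[unfolded rows_zero_def row_def split_conv r]
  have v1: "B2 (x - a - 2 * s) = 0" "B2 (x - a - s) = \<sigma> - a + x + \<alpha>" "B2 (x - a + s) = \<sigma> + a - x"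
    "B2 (x - 2 * s) = 0" "B2 (x - s) = \<sigma> + x" "B2 (x + s) = \<sigma> - x"
    using a s x by (auto simp: B2_eq \<sigma>_def \<alpha>_def)
  have E0: "(\<sigma> - x) * z + (\<sigma> + x) * q = 0" using rows unfolding v1 by (simp add: mult.commute)
  have E1: "(\<sigma> + a - x) * z + (\<sigma> - a + x + \<alpha>) * q = 0" using rows unfolding v1 by (simp add: mult.commute)
  have E: "a * z + (\<alpha> - a) * q = 0" using E0 E1 by algebra
  have "0 < a * (\<sigma> + x) + (\<sigma> - x) * (a - \<alpha>)"
    using a x \<sigma> by (intro add_pos_nonneg mult_pos_pos mult_nonneg_nonneg) (auto simp: \<alpha>_def)
  then have "(\<sigma> - x) * (\<alpha> - a) \<noteq> (\<sigma> + x) * a" by (simp add: algebra_simps)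
  then have "z = 0" "q = 0" using two_by_two_kernel[OF E0, of "\<alpha> - a" a] E by (auto simp: algebra_simps)
  \<comment> \<open>\<open>4 * s < 2 + 3 * a\<close> gives \<open>2 * a - 2 * s > a / 2 - 1\<close>,
    so \<open>y - 2 * s\<close> is inside the support.\<close>
  moreover have "B2 (x + 2 * a - 2 * s) > 0" using a s x by (auto simp: B2_eq)
  ultimately show ?thesis using rows r by auto
qed

subsection \<open>Recovering a function from its periodised sums\<close>

text \<open>With \<open>c = k * a\<close> this is \<open>F_k(y)\<close>. The index set is the open
  support, which is finite for \<open>s > 0\<close>. The codomain is kept general because recovery
  is proved for real functions and transferred to complex ones through real and imaginary
  parts.\<close>

definition hat_sum :: "real \<Rightarrow> (real \<Rightarrow> 'a::real_normed_vector) \<Rightarrow> real \<Rightarrow> real \<Rightarrow> 'a" where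
  "hat_sum s f y c =
     (\<Sum>n | \<bar>y + of_int n * s - c\<bar> < 1. B2 (y + of_int n * s - c) *\<^sub>R f (y + of_int n * s))"

lemma finite_hat_support:
  fixes s y c :: real
  assumes "s > 0"
  shows "finite {n::int. \<bar>y + of_int n * s - c\<bar> < 1}"
proof (rule finite_subset)
  show "{n::int. \<bar>y + of_int n * s - c\<bar> < 1} \<subseteq> {\<lfloor>(c - 1 - y) / s\<rfloor>..\<lceil>(c + 1 - y) / s\<rceil>}"
  proof
    fix n :: int
    assume "n \<in> {n. \<bar>y + of_int n * s - c\<bar> < 1}"
    then have "(c - 1 - y) / s \<le> of_int n" "of_int n \<le> (c + 1 - y) / s"
      using assms by (auto simp: pos_divide_le_eq pos_le_divide_eq)
    then show "n \<in> {\<lfloor>(c - 1 - y) / s\<rfloor>..\<lceil>(c + 1 - y) / s\<rceil>}"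
      by (simp add: floor_le_iff le_ceiling_iff)
  qed
qed simp

lemma hat_sum_eq:
  assumes "s > 0" "finite I" "\<And>n. \<bar>y + of_int n * s - c\<bar> < 1 \<Longrightarrow> n \<in> I"
  shows "hat_sum s f y c = (\<Sum>n\<in>I. B2 (y + of_int n * s - c) *\<^sub>R f (y + of_int n * s))"
  unfolding hat_sum_def
  by (rule sum.mono_neutral_left) (use assms in \<open>auto simp: B2_eq\<close>)

lemma hat_sum_shift: "hat_sum s f (y + of_int m * s) c = hat_sum s f y c"
  unfolding hat_sum_def
  by (rule sum.reindex_bij_witness[of _ "\<lambda>n. n - m" "\<lambda>n. n + m"]) (auto simp: algebra_simps)

lemma B2_minus: "B2 (- x) = B2 x"
  by (simp add: B2_eq)

lemma hat_sum_reflect: "hat_sum s (\<lambda>x. f (- x)) (- y) (- c) = hat_sum s f y c"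
  unfolding hat_sum_def
proof (rule sum.reindex_bij_witness[of _ uminus uminus])
  fix n :: int
  have "- (- y + of_int n * s) = y + of_int (- n) * s" "- y + of_int n * s - - c = - (y + of_int (- n) * s - c)"
    by simp_all
  then show "B2 (y + of_int (- n) * s - c) *\<^sub>R f (y + of_int (- n) * s) =
    B2 (- y + of_int n * s - - c) *\<^sub>R f (- (- y + of_int n * s))"
    by (simp only: B2_minus)
qed (auto simp: abs_if split: if_splits)

lemma hat_sum_bounded_linear:
  assumes "bounded_linear h"
  shows "h (hat_sum s f y c) = hat_sum s (\<lambda>x. h (f x)) y c"
  unfolding hat_sum_def using assms by (simp add: linear_sum linear_scale bounded_linear.linear)

text \<open>The two inequalities put \<open>y + 2 * s\<close> and \<open>y - 3 * s\<close> outside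
  the open support. For offsets from \<open>x - a\<close> to \<open>x + 2 * a\<close> they become
  \<open>1 + a \<le> 2 * s\<close> and \<open>1 + x + 2 * a \<le> 3 * s\<close>.\<close>

lemma hat_sum_eq_row:
  fixes f :: "real \<Rightarrow> real"
  assumes "s > 0" "1 \<le> y - c + 2 * s" "y - c - 3 * s \<le> - 1"
  shows "hat_sum s f y c = row s (f (y - 2 * s), f (y - s), f y, f (y + s)) (y - c)"
proof -
  have "hat_sum s f y c = (\<Sum>n\<in>{-2, -1, 0, 1}. B2 (y + of_int n * s - c) *\<^sub>R f (y + of_int n * s))"
  proof (rule hat_sum_eq)
    fix n :: int
    assume n: "\<bar>y + of_int n * s - c\<bar> < 1"
    have "\<not> 2 \<le> n"
    proof
      assume "2 \<le> n"
      then have "2 * s \<le> of_int n * s" using assms(1) by (intro mult_right_mono) auto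
      then show False using n assms by linarith
    qed
    moreover have "\<not> n \<le> -3"
    proof
      assume "n \<le> -3"
      then have "of_int n * s \<le> (-3) * s" using assms(1) by (intro mult_right_mono) auto
      then show False using n assms by linarith
    qed
    ultimately have "n = -2 \<or> n = -1 \<or> n = 0 \<or> n = 1" by linarith
    then show "n \<in> {-2, -1, 0, 1}" by simp
  qed (use assms in auto)
  then show ?thesis by (simp add: row_def algebra_simps)
qed

section \<open>Uniform constants from compactness, and propagation of recoverability\<close>

lemma continuous_on_B2 [continuous_intros]:
  "continuous_on S f \<Longrightarrow> continuous_on S (\<lambda>x. B2 (f x))"
  unfolding B2_eq by (intro continuous_intros)

definition rows_norm :: "real \<Rightarrow> real \<Rightarrow> real \<Rightarrow> real \<times> real \<times> real \<times> real \<Rightarrow> real" where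
  "rows_norm s a x v =
     \<bar>row s v (x - a)\<bar> + \<bar>row s v x\<bar> + \<bar>row s v (x + a)\<bar> + \<bar>row s v (x + 2 * a)\<bar>"

text \<open>On \<open>{0..T}\<close> times the unit sphere the continuous function
  \<open>rows_norm\<close> attains its minimum, which is positive because the kernel is trivial;
  homogeneity in \<open>v\<close> covers all other vectors.\<close>

lemma rows_norm_lower_bound:
  assumes ker: "\<And>x p q r z. 0 \<le> x \<Longrightarrow> x \<le> T \<Longrightarrow> rows_zero s a x (p, q, r, z) \<Longrightarrow>
      p = 0 \<and> q = 0 \<and> r = 0 \<and> z = 0" and T: "0 \<le> T"
  shows "\<exists>c>0. \<forall>x v. 0 \<le> x \<longrightarrow> x \<le> T \<longrightarrow> c * norm v \<le> rows_norm s a x v"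
proof -
  let ?K = "{0..T} \<times> sphere (0 :: real \<times> real \<times> real \<times> real) 1"
  have row: "row s v t = fst v * B2 (t - 2 * s) + fst (snd v) * B2 (t - s)
      + fst (snd (snd v)) * B2 t + snd (snd (snd v)) * B2 (t + s)" for v t
    by (simp add: row_def split_beta)
  have "continuous_on ?K (\<lambda>w. rows_norm s a (fst w) (snd w))"
    unfolding rows_norm_def row by (intro continuous_intros)
  moreover have "compact ?K" by (intro compact_Times compact_Icc compact_sphere)
  moreover have "(1, 0, 0, 0) \<in> sphere (0 :: real \<times> real \<times> real \<times> real) 1" by (simp add: norm_Pair)
  then have "?K \<noteq> {}" using T by auto
  ultimately obtain w0 where w0: "w0 \<in> ?K"
    "\<And>w. w \<in> ?K \<Longrightarrow> rows_norm s a (fst w0) (snd w0) \<le> rows_norm s a (fst w) (snd w)"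
    using continuous_attains_inf[of ?K "\<lambda>w. rows_norm s a (fst w) (snd w)"] by blast
  define c where "c = rows_norm s a (fst w0) (snd w0)"
  obtain x0 p q r z where x0: "w0 = (x0, p, q, r, z)" by (metis prod.collapse)
  have "c \<noteq> 0"
  proof
    assume "c = 0"
    then have "rows_zero s a x0 (p, q, r, z)" by (auto simp: c_def x0 rows_norm_def rows_zero_def)
    then have "(p, q, r, z) = 0" using ker[of x0 p q r z] w0(1) x0 by (auto simp: zero_prod_def)
    then show False using w0(1) x0 by simp
  qed
  moreover have "c \<ge> 0" unfolding c_def rows_norm_def by simp
  ultimately have "c > 0" by simp
  moreover have "c * norm v \<le> rows_norm s a x v" if x: "0 \<le> x" "x \<le> T" for x v
  proof (cases "v = 0")
    case True
    then show ?thesis by (simp add: rows_norm_def)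
  next
    case False
    have sc: "row s (k *\<^sub>R v) t = k * row s v t" for k t
      unfolding row by (simp add: algebra_simps)
    have sc': "rows_norm s a x (k *\<^sub>R v) = \<bar>k\<bar> * rows_norm s a x v" for k
      unfolding rows_norm_def sc by (simp add: abs_mult algebra_simps)
    have "(x, (1 / norm v) *\<^sub>R v) \<in> ?K" using x False by simp
    from w0(2)[OF this] have "c \<le> (1 / norm v) * rows_norm s a x v"
      unfolding c_def by (simp add: sc' del: scaleR_Pair)
    then show ?thesis using False by (simp add: field_simps)
  qed
  ultimately show ?thesis by blast
qed

text \<open>The constants depend on \<open>s\<close>, \<open>a\<close>, \<open>T\<close> but not on
  \<open>f\<close>, \<open>y\<close>, \<open>k\<close>. For \<open>T = a / 2\<close> every real
  \<open>y\<close> is covered by some \<open>k\<close>. The number \<open>N\<close> is left free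
  because each propagation step enlarges the window of sums.\<close>

definition recoverable :: "real \<Rightarrow> real \<Rightarrow> real \<Rightarrow> bool" where
  "recoverable s a T \<longleftrightarrow> (\<exists>C\<ge>0. \<exists>N\<ge>0::int. \<forall>(f::real \<Rightarrow> real) y (k::int). \<bar>y - of_int k * a\<bar> \<le> T \<longrightarrow>
     \<bar>f y\<bar> \<le> C * (\<Sum>j\<in>{-N..N}. \<bar>hat_sum s f y (of_int (k + j) * a)\<bar>))"

text \<open>The hat is even, so reflecting \<open>f\<close>, \<open>y\<close> and the centres turns
  the offset \<open>y - k * a\<close> into its negative. The window \<open>{-N..N}\<close> is
  symmetric so that the reflection maps it to itself.\<close>

lemma recoverable_one_sided:
  fixes C :: real
  assumes C: "C \<ge> 0" "N \<ge> 0"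
    and *: "\<And>(f :: real \<Rightarrow> real) y k. 0 \<le> y - of_int k * a \<Longrightarrow> y - of_int k * a \<le> T \<Longrightarrow>
       \<bar>f y\<bar> \<le> C * (\<Sum>j\<in>{-N..N}. \<bar>hat_sum s f y (of_int (k + j) * a)\<bar>)"
  shows "recoverable s a T"
proof -
  have main: "\<bar>f y\<bar> \<le> C * (\<Sum>j\<in>{-N..N}. \<bar>hat_sum s f y (of_int (k + j) * a)\<bar>)"
    if y: "\<bar>y - of_int k * a\<bar> \<le> T" for f :: "real \<Rightarrow> real" and y k
  proof (cases "0 \<le> y - of_int k * a")
    case True
    then show ?thesis using * y by auto
  next
    case False
    let ?g = "\<lambda>x. f (- x)"
    have "\<bar>?g (- y)\<bar> \<le> C * (\<Sum>j\<in>{-N..N}. \<bar>hat_sum s ?g (- y) (of_int (- k + j) * a)\<bar>)"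
      by (rule *) (use False y in auto)
    also have "(\<Sum>j\<in>{-N..N}. \<bar>hat_sum s ?g (- y) (of_int (- k + j) * a)\<bar>)
        = (\<Sum>j\<in>{-N..N}. \<bar>hat_sum s f y (of_int (k + j) * a)\<bar>)"
    proof (rule sum.reindex_bij_witness[of _ uminus uminus])
      fix j
      have "of_int (- k + j) * a = - (of_int (k + - j) * a)" by (simp add: algebra_simps)
      then show "\<bar>hat_sum s f y (of_int (k + - j) * a)\<bar> = \<bar>hat_sum s ?g (- y) (of_int (- k + j) * a)\<bar>"
        by (simp only: hat_sum_reflect)
    qed auto
    finally show ?thesis by simp
  qed
  show ?thesis
    unfolding recoverable_def by (intro exI[of _ C] exI[of _ N] conjI C allI impI main)
qed

lemma recoverable_mono: "recoverable s a T \<Longrightarrow> T' \<le> T \<Longrightarrow> recoverable s a T'"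
  unfolding recoverable_def by (meson order_trans)

lemma recoverable_from_kernel:
  assumes ker: "\<And>x p q r z. 0 \<le> x \<Longrightarrow> x \<le> T \<Longrightarrow> rows_zero s a x (p, q, r, z) \<Longrightarrow>
      p = 0 \<and> q = 0 \<and> r = 0 \<and> z = 0" and T: "0 \<le> T" and s: "s > 0"
    and a: "0 \<le> a" "1 + a \<le> 2 * s" "1 + T + 2 * a \<le> 3 * s"
  shows "recoverable s a T"
proof -
  obtain c where c: "c > 0" "\<And>x v. 0 \<le> x \<Longrightarrow> x \<le> T \<Longrightarrow> c * norm v \<le> rows_norm s a x v"
    using rows_norm_lower_bound[of T s a] ker T by blast
  have "\<bar>f y\<bar> \<le> (1 / c) * (\<Sum>j\<in>{-2..2}. \<bar>hat_sum s f y (of_int (k + j) * a)\<bar>)"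
    if x: "0 \<le> y - of_int k * a" "y - of_int k * a \<le> T" for f :: "real \<Rightarrow> real" and y and k :: int
  proof -
    define x where "x = y - of_int k * a"
    let ?v = "(f (y - 2 * s), f (y - s), f y, f (y + s))"
    let ?h = "\<lambda>j. \<bar>hat_sum s f y (of_int (k + j) * a)\<bar>"
    have h: "?h j = \<bar>row s ?v (x - of_int j * a)\<bar>" if "j \<in> {-2..1}" for j
    proof -
      have "of_int j * a \<le> 1 * a" "(-2) * a \<le> of_int j * a"
        using that a by (intro mult_right_mono; simp)+
      then show ?thesis using x a s
        by (subst hat_sum_eq_row) (auto simp: x_def algebra_simps)
    qed
    have "\<bar>f y\<bar> \<le> norm ?v"
      using norm_snd_le[where x = "f (y - 2 * s)" and y = "(f (y - s), f y, f (y + s))"]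
        norm_snd_le[where x = "f (y - s)" and y = "(f y, f (y + s))"]
        norm_fst_le[where x = "f y" and y = "f (y + s)"]
      by simp
    also have "\<dots> \<le> (1 / c) * rows_norm s a x ?v"
      using c(2)[of x ?v] x c(1) by (simp add: x_def field_simps)
    also have "rows_norm s a x ?v = (\<Sum>j\<in>{-2..1}. ?h j)"
    proof -
      have "{-2..1} = {-2, -1, 0, 1::int}" by auto
      then have "(\<Sum>j\<in>{-2..1}. ?h j) = ?h (-2) + ?h (-1) + ?h 0 + ?h 1" by simp
      also have "\<dots> = rows_norm s a x ?v"
        using h[of "-2"] h[of "-1"] h[of 0] h[of 1] by (simp add: rows_norm_def)
      finally show ?thesis by simp
    qed
    \<comment> \<open>The four rows occupy the indices \<open>-2\<close> to \<open>1\<close>; the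
      index \<open>2\<close> is added only to make the window symmetric.\<close>
    also have "(1 / c) * (\<Sum>j\<in>{-2..1}. ?h j) \<le> (1 / c) * (\<Sum>j\<in>{-2..2}. ?h j)"
      using c(1) by (intro mult_left_mono sum_mono2) auto
    finally show ?thesis .
  qed
  from recoverable_one_sided[OF _ _ this] show ?thesis using c(1) by simp
qed

text \<open>For an offset \<open>t > T\<close>, the condition \<open>1 \<le> s + T\<close> removes
  \<open>y + s\<close> from the sum \<open>F_k\<close>, which then contains only \<open>y\<close>
  and \<open>y - s\<close>. Relative to \<open>(k - 1) * a\<close> the point \<open>y - s\<close>
  has offset \<open>t - (s - a)\<close>, which lies between \<open>- T\<close> and \<open>T\<close>,
  so \<open>f (y - s)\<close> is already controlled and \<open>f y\<close> can be solved
  for.\<close>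

lemma recoverable_step:
  assumes R: "recoverable s a T" and a: "0 < a" "a \<le> 1" "a < s" "1 + a \<le> 2 * s" "1 \<le> s + T" "s - a \<le> T"
    and T': "T' \<le> T + (s - a)" "2 * T' \<le> a"
  shows "recoverable s a T'"
proof -
  obtain C N where C: "C \<ge> 0" "N \<ge> (0::int)"
    and R: "\<And>(f::real \<Rightarrow> real) y (k::int). \<bar>y - of_int k * a\<bar> \<le> T \<Longrightarrow>
     \<bar>f y\<bar> \<le> C * (\<Sum>j\<in>{-N..N}. \<bar>hat_sum s f y (of_int (k + j) * a)\<bar>)"
    using R unfolding recoverable_def by blast
  have "\<bar>f y\<bar> \<le> (2 * (1 + C)) * (\<Sum>j\<in>{-(N+1)..N+1}. \<bar>hat_sum s f y (of_int (k + j) * a)\<bar>)"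
    if y: "0 \<le> y - of_int k * a" "y - of_int k * a \<le> T'" for f :: "real \<Rightarrow> real" and y and k :: int
  proof -
    let ?h = "\<lambda>j. \<bar>hat_sum s f y (of_int (k + j) * a)\<bar>"
    define H where "H = (\<Sum>j\<in>{-(N+1)..N+1}. ?h j)"
    have H0: "0 \<le> H" unfolding H_def by (intro sum_nonneg) auto
    have sub: "(\<Sum>j\<in>J. ?h j) \<le> H" if "J \<subseteq> {-(N+1)..N+1}" for J
      unfolding H_def using that by (intro sum_mono2) auto
    show ?thesis
    proof (cases "y - of_int k * a \<le> T")
      case True
      have "\<bar>f y\<bar> \<le> C * (\<Sum>j\<in>{-N..N}. ?h j)" using R True y by auto
      also have "\<dots> \<le> C * H" using C by (intro mult_left_mono sub) auto
      also have "\<dots> \<le> (2 * (1 + C)) * H" using C H0 by (intro mult_right_mono) auto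
      finally show ?thesis unfolding H_def .
    next
      case False
      define t where "t = y - of_int k * a"
      have t: "T < t" "t \<le> T'" using False y by (auto simp: t_def)
      have "hat_sum s f y (of_int (k + 0) * a) = row s (f (y - 2 * s), f (y - s), f y, f (y + s)) t"
        using a t T' by (subst hat_sum_eq_row) (auto simp: t_def)
      also have "\<dots> = f (y - s) * B2 (t - s) + (1 - t) * f y"
      proof -
        have "B2 (t - 2 * s) = 0" "B2 (t + s) = 0" "B2 t = 1 - t" using a t T' y by (auto simp: B2_eq)
        then show ?thesis by (simp add: row_def)
      qed
      finally have e: "(1 - t) * f y = hat_sum s f y (of_int (k + 0) * a) - f (y - s) * B2 (t - s)" by linarith
      have "\<bar>f (y - s) * B2 (t - s)\<bar> \<le> \<bar>f (y - s)\<bar> * 1"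
        unfolding abs_mult by (intro mult_left_mono) (auto simp: B2_eq)
      then have "\<bar>(1 - t) * f y\<bar> \<le> ?h 0 + \<bar>f (y - s)\<bar>" unfolding e by linarith
      \<comment> \<open>\<open>t \<le> a / 2 \<le> 1/2\<close>, so the coefficient
        \<open>1 - t\<close> is at least one half.\<close>
      moreover have "(1/2) * \<bar>f y\<bar> \<le> \<bar>(1 - t) * f y\<bar>"
        unfolding abs_mult using t T' a by (intro mult_right_mono) auto
      ultimately have h: "(1/2) * \<bar>f y\<bar> \<le> ?h 0 + \<bar>f (y - s)\<bar>" by (rule order_trans[rotated])
      have "u \<le> 2 * v" if "(1/2) * u \<le> v" for u v :: real using that by simp
      from this[OF h] have 1: "\<bar>f y\<bar> \<le> 2 * (?h 0 + \<bar>f (y - s)\<bar>)" .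
      have 2: "?h 0 \<le> H" using sub[of "{0}"] C by simp
      have "\<bar>f (y - s)\<bar> \<le> C * (\<Sum>j\<in>{-N..N}. \<bar>hat_sum s f (y - s) (of_int ((k - 1) + j) * a)\<bar>)"
      proof (rule R)
        have "y - s - of_int (k - 1) * a = t - (s - a)" by (simp add: t_def algebra_simps)
        then show "\<bar>y - s - of_int (k - 1) * a\<bar> \<le> T" using t T' a by linarith
      qed
      also have "(\<Sum>j\<in>{-N..N}. \<bar>hat_sum s f (y - s) (of_int ((k - 1) + j) * a)\<bar>) = (\<Sum>j\<in>{-(N+1)..N-1}. ?h j)"
      proof (rule sum.reindex_bij_witness[of _ "\<lambda>j. j + 1" "\<lambda>j. j - 1"])
        fix j
        have "hat_sum s f (y - s) c = hat_sum s f y c" for c using hat_sum_shift[of s f y "-1" c] by simp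
        then show "?h (j - 1) = \<bar>hat_sum s f (y - s) (of_int ((k - 1) + j) * a)\<bar>"
          by (simp add: algebra_simps)
      qed auto
      also have "C * \<dots> \<le> C * H" using C by (intro mult_left_mono sub) auto
      finally have "\<bar>f (y - s)\<bar> \<le> C * H" .
      then have "2 * (?h 0 + \<bar>f (y - s)\<bar>) \<le> 2 * (H + C * H)" by (intro mult_left_mono add_mono 2) simp_all
      with 1 have "\<bar>f y\<bar> \<le> 2 * (H + C * H)" by (rule order_trans)
      then show ?thesis by (simp add: H_def algebra_simps)
    qed
  qed
  from recoverable_one_sided[OF _ _ this] show ?thesis using C by simp
qed

lemma recoverable_near:
  assumes s: "s < 1" "2 * (1 - s) \<le> a" "1 + a \<le> 2 * s" and d: "s - a < 1/2"
  shows "recoverable s a (a / 2)"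
proof -
  have R: "recoverable s a (s - a)"
    using s d by (intro recoverable_from_kernel) (auto dest: rows_kernel_near[OF s d])
  \<comment> \<open>Each step gains \<open>s - a\<close>, which is positive since
    \<open>1 + a \<le> 2 * s < 2\<close>. The cap at \<open>a / 2\<close> maintains the condition
    \<open>2 * T' \<le> a\<close> of the step.\<close>
  have "recoverable s a (min (a / 2) (real (Suc n) * (s - a)))" for n
  proof (induction n)
    case 0
    show ?case using R by (rule recoverable_mono) simp
  next
    case (Suc n)
    show ?case
    proof (cases "a / 2 \<le> real (Suc n) * (s - a)")
      case True
      then show ?thesis using Suc by (rule_tac recoverable_mono[OF Suc.IH]) simp
    next
      case False
      have "s - a \<le> real (Suc n) * (s - a)" using s mult_right_mono[of 1 "real (Suc n)" "s - a"] by simp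
      moreover from this have "1 \<le> s + real (Suc n) * (s - a)" using s by linarith
      moreover have "2 * min (a / 2) (real (Suc (Suc n)) * (s - a)) \<le> a" by (simp add: min_def)
      moreover have "min (a / 2) (real (Suc (Suc n)) * (s - a)) \<le> real (Suc n) * (s - a) + (s - a)"
        by (simp add: min_def algebra_simps)
      ultimately show ?thesis using False s by (intro recoverable_step[OF Suc.IH]) (simp_all add: min_def del: of_nat_Suc)
    qed
  qed
  note R' = this
  obtain n where "a / 2 < real n * (s - a)"
    using reals_Archimedean3[of "s - a", THEN spec, of "a / 2"] s by (auto simp: field_simps)
  moreover have "real (Suc n) * (s - a) = real n * (s - a) + (s - a)" by (simp add: algebra_simps)
  ultimately have "min (a / 2) (real (Suc n) * (s - a)) = a / 2" using s by linarith
  then show ?thesis using R'[of n] by simp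
qed

lemma recoverable_far:
  assumes a: "0 < a" "a < 1/2" "a \<le> 2/9 \<or> 2/7 < a"
    and s: "1 + a \<le> 2 * s" "4 * s < 2 + 3 * a" "a < 2 * (1 - s)"
  shows "recoverable s a (a / 2)"
  using a s by (intro recoverable_from_kernel) (auto dest: rows_kernel_far[OF a s])

subsection \<open>Trigonometric approximation\<close>

definition fourier_exp :: "real \<Rightarrow> int \<Rightarrow> real \<Rightarrow> complex" where
  "fourier_exp b l y = exp (\<i> * complex_of_real (2 * pi * (of_int l * b) * y))"

lemma fourier_exp_0 [simp]: "fourier_exp b 0 y = 1"
  by (simp add: fourier_exp_def)

lemma fourier_exp_add: "fourier_exp b (l + m) y = fourier_exp b l y * fourier_exp b m y"
  by (simp add: fourier_exp_def algebra_simps flip: exp_add)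

lemma norm_fourier_exp [simp]: "cmod (fourier_exp b l y) = 1"
  by (simp add: fourier_exp_def)

lemma cnj_fourier_exp: "cnj (fourier_exp b l y) = fourier_exp b (- l) y"
  by (simp add: fourier_exp_def exp_cnj)

lemma continuous_on_fourier_exp [continuous_intros]: "continuous_on S (fourier_exp b l)"
  unfolding fourier_exp_def by (intro continuous_intros)

lemma fourier_exp_periodic:
  assumes "b > 0"
  shows "fourier_exp b l (y + of_int n / b) = fourier_exp b l y"
  unfolding fourier_exp_def exp_eq
proof
  show "\<i> * complex_of_real (2 * pi * (of_int l * b) * (y + of_int n / b))
    = \<i> * complex_of_real (2 * pi * (of_int l * b) * y) + complex_of_real (of_int (2 * (l * n)) * pi) * \<i>"
    using assms by (simp add: field_simps)
qed

lemma fourier_exp_1_eq_iff: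
  assumes "b > 0"
  shows "fourier_exp b 1 y = fourier_exp b 1 y' \<longleftrightarrow> (\<exists>n::int. y = y' + of_int n / b)"
proof -
  have "fourier_exp b 1 y = fourier_exp b 1 y' \<longleftrightarrow>
      (\<exists>n::int. 2 * pi * b * y = 2 * pi * b * y' + of_int (2 * n) * pi)"
    unfolding fourier_exp_def exp_eq by (intro ex_cong1) (simp add: complex_eq_iff)
  also have "\<dots> \<longleftrightarrow> (\<exists>n::int. y = y' + of_int n / b)"
  proof (intro ex_cong1)
    fix n :: int
    have "2 * pi * b * y = 2 * pi * b * y' + of_int (2 * n) * pi \<longleftrightarrow>
        (2 * pi) * (b * y) = (2 * pi) * (b * y' + of_int n)"
      by (simp add: algebra_simps)
    also have "\<dots> \<longleftrightarrow> b * y = b * y' + of_int n"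
      unfolding mult_cancel_left by simp
    also have "\<dots> \<longleftrightarrow> y = y' + of_int n / b" using assms by (simp add: field_simps)
    finally show "2 * pi * b * y = 2 * pi * b * y' + of_int (2 * n) * pi \<longleftrightarrow> y = y' + of_int n / b" .
  qed
  finally show ?thesis .
qed

lemma fourier_exp_1_surj:
  assumes b: "b > 0" and z: "cmod z = 1"
  shows "\<exists>y\<in>{c..c + 1 / b}. fourier_exp b 1 y = z"
proof -
  define y0 where "y0 = Arg z / (2 * pi * b)"
  define n where "n = - \<lfloor>(y0 - c) * b\<rfloor>"
  have "fourier_exp b 1 (y0 + of_int n / b) = fourier_exp b 1 y0"
    by (rule fourier_exp_periodic[OF b])
  also have "\<dots> = z"
  proof -
    have "z \<noteq> 0" using z by auto
    then show ?thesis using b z Arg_eq[of z] by (simp add: fourier_exp_def y0_def)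
  qed
  finally have "fourier_exp b 1 (y0 + of_int n / b) = z" .
  moreover have "y0 + of_int n / b \<in> {c..c + 1 / b}"
  proof -
    have "of_int (- n) \<le> (y0 - c) * b" "(y0 - c) * b \<le> of_int (- n) + 1"
      unfolding n_def by linarith+
    then have "of_int (- n) / b \<le> y0 - c" "y0 - c \<le> (of_int (- n) + 1) / b"
      using b by (simp_all only: pos_divide_le_eq pos_le_divide_eq)
    then show ?thesis by (simp add: diff_divide_distrib)
  qed
  ultimately show ?thesis by blast
qed

text \<open>The inductive form makes closure under products and continuity plain inductions; the
  expansion as a finite sum is extracted afterwards.\<close>

inductive trig_poly :: "real \<Rightarrow> (real \<Rightarrow> complex) \<Rightarrow> bool" for b where
  monomial: "trig_poly b (\<lambda>y. c * fourier_exp b l y)"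
| add: "trig_poly b f \<Longrightarrow> trig_poly b g \<Longrightarrow> trig_poly b (\<lambda>y. f y + g y)"

lemma trig_poly_mult:
  assumes "trig_poly b f" "trig_poly b g"
  shows "trig_poly b (\<lambda>y. f y * g y)"
  using assms(1)
proof induction
  case (monomial c l)
  show ?case using assms(2)
  proof induction
    case (monomial d m)
    have "(\<lambda>y. c * fourier_exp b l y * (d * fourier_exp b m y)) = (\<lambda>y. (c * d) * fourier_exp b (l + m) y)"
      by (simp add: fourier_exp_add mult_ac)
    then show ?case using trig_poly.monomial[of b "c * d" "l + m"] by simp
  qed (simp add: ring_distribs trig_poly.add)
qed (simp add: ring_distribs trig_poly.add)

lemma trig_poly_cmult:
  assumes "trig_poly b f"
  shows "trig_poly b (\<lambda>y. c * f y)"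
  using trig_poly_mult[OF trig_poly.monomial[of b c 0] assms] by simp

lemma trig_poly_expansion:
  assumes "trig_poly b f"
  shows "\<exists>L a. finite L \<and> f = (\<lambda>y. \<Sum>l\<in>L. a l * fourier_exp b l y)"
  using assms
proof induction
  case (monomial c l)
  show ?case by (intro exI[of _ "{l}"] exI[of _ "\<lambda>_. c"]) simp
next
  case (add f g)
  then obtain L a K d where L: "finite L" "f = (\<lambda>y. \<Sum>l\<in>L. a l * fourier_exp b l y)"
    and K: "finite K" "g = (\<lambda>y. \<Sum>l\<in>K. d l * fourier_exp b l y)" by (elim exE conjE)
  have "f y = (\<Sum>l\<in>L \<union> K. (if l \<in> L then a l else 0) * fourier_exp b l y)" for y
    unfolding L(2) using L(1) K(1) by (intro sum.mono_neutral_cong_left) auto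
  moreover have "g y = (\<Sum>l\<in>L \<union> K. (if l \<in> K then d l else 0) * fourier_exp b l y)" for y
    unfolding K(2) using L(1) K(1) by (intro sum.mono_neutral_cong_left) auto
  ultimately have "(\<lambda>y. f y + g y) = (\<lambda>y. \<Sum>l\<in>L \<union> K.
      ((if l \<in> L then a l else 0) + (if l \<in> K then d l else 0)) * fourier_exp b l y)"
    by (simp only: sum.distrib ring_distribs)
  moreover have "finite (L \<union> K)" using L(1) K(1) by simp
  ultimately show ?case by (intro exI conjI)
qed

text \<open>The case with content is the linear one: a real-linear functional on the complex numbers
  has the form \<open>A * z + B * cnj z\<close>, and conjugation sends the exponential of index 1 to
  that of index -1.\<close>

lemma trig_poly_real_polynomial:
  fixes p :: "complex \<Rightarrow> real"
  assumes "real_polynomial_function p"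
  shows "trig_poly b (\<lambda>y. complex_of_real (p (fourier_exp b 1 y)))"
  using assms
proof induction
  case (linear f)
  interpret bounded_linear f by fact
  have f: "f z = Re z * f 1 + Im z * f \<i>" for z
  proof -
    have "z = Re z *\<^sub>R 1 + Im z *\<^sub>R \<i>" by (simp add: complex_eq_iff)
    then have "f z = f (Re z *\<^sub>R 1 + Im z *\<^sub>R \<i>)" by simp
    then show ?thesis by (simp add: add scaleR)
  qed
  define A where "A = (f 1 - \<i> * f \<i>) / 2"
  define B where "B = (f 1 + \<i> * f \<i>) / 2"
  have "complex_of_real (f z) = A * z + B * cnj z" for z
    unfolding f[of z] A_def B_def by (simp add: complex_eq_iff field_simps)
  then have "(\<lambda>y. complex_of_real (f (fourier_exp b 1 y))) =
     (\<lambda>y. A * fourier_exp b 1 y + B * fourier_exp b (-1) y)"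
    by (simp add: cnj_fourier_exp)
  then show ?case by (simp only:) (intro trig_poly.intros)
next
  case (const c)
  show ?case using trig_poly.monomial[of b "complex_of_real c" 0] by simp
qed (simp_all add: trig_poly.add trig_poly_mult)

lemma trig_poly_polynomial:
  fixes p :: "complex \<Rightarrow> complex"
  assumes "polynomial_function p"
  shows "trig_poly b (\<lambda>y. p (fourier_exp b 1 y))"
proof -
  have "p z = complex_of_real (p z \<bullet> 1) + \<i> * complex_of_real (p z \<bullet> \<i>)" for z
    by (simp add: complex_eq_iff inner_complex_def)
  then have eq: "(\<lambda>y. p (fourier_exp b 1 y)) = (\<lambda>y. complex_of_real (p (fourier_exp b 1 y) \<bullet> 1)
      + \<i> * complex_of_real (p (fourier_exp b 1 y) \<bullet> \<i>))" by blast
  have "real_polynomial_function (\<lambda>z. p z \<bullet> 1)" "real_polynomial_function (\<lambda>z. p z \<bullet> \<i>)"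
    using assms polynomial_function_iff_Basis_inner[of p] by (auto simp: Basis_complex_def)
  then have "trig_poly b (\<lambda>y. complex_of_real (p (fourier_exp b 1 y) \<bullet> 1))"
    "trig_poly b (\<lambda>y. \<i> * complex_of_real (p (fourier_exp b 1 y) \<bullet> \<i>))"
    using trig_poly_real_polynomial trig_poly_cmult by blast+
  from trig_poly.add[OF this] show ?thesis by (subst eq)
qed

text \<open>The first exponential maps the compact period onto the circle and identifies only its
  endpoints. Continuity of the induced map holds because the preimage of a closed set is the image
  of a compact set.\<close>

lemma periodic_factors_through_circle:
  fixes f :: "real \<Rightarrow> complex"
  assumes b: "b > 0" and f: "continuous_on {c..c + 1 / b} f" "f c = f (c + 1 / b)"
  obtains p where "continuous_on (sphere 0 1) p" "\<And>y. y \<in> {c..c + 1 / b} \<Longrightarrow> p (fourier_exp b 1 y) = f y"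
proof -
  let ?I = "{c..c + 1 / b}"
  define p where "p z = f (SOME y. y \<in> ?I \<and> fourier_exp b 1 y = z)" for z
  have eq: "f y = f y'" if y: "y \<in> ?I" "y' \<in> ?I" and e: "fourier_exp b 1 y = fourier_exp b 1 y'" for y y'
  proof -
    obtain n :: int where n: "y = y' + of_int n / b" using e fourier_exp_1_eq_iff[OF b] by blast
    have "\<bar>of_int n / b\<bar> \<le> 1 / b" using n y by auto
    then have "\<bar>of_int n :: real\<bar> \<le> 1" using b by (simp add: field_simps abs_mult)
    then consider "n = 0" | "n = 1" | "n = -1" by linarith
    then show ?thesis
    proof cases
      case 2
      then have "y' = c" "y = c + 1 / b" using n y by auto
      then show ?thesis using f(2) by simp
    next
      case 3
      then have "y = c" "y' = c + 1 / b" using n y by auto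
      then show ?thesis using f(2) by simp
    qed (use n in simp)
  qed
  have p: "p (fourier_exp b 1 y) = f y" if "y \<in> ?I" for y
  proof -
    have "\<exists>y'. y' \<in> ?I \<and> fourier_exp b 1 y' = fourier_exp b 1 y" using that by blast
    from someI_ex[OF this] show ?thesis unfolding p_def using eq that by blast
  qed
  have "continuous_on (sphere 0 1) p"
  proof (subst continuous_on_closed_vimage, simp, intro allI impI)
    fix B :: "complex set"
    assume "closed B"
    have "p -` B \<inter> sphere 0 1 = fourier_exp b 1 ` (f -` B \<inter> ?I)"
    proof (intro equalityI subsetI)
      fix z assume z: "z \<in> p -` B \<inter> sphere 0 1"
      then have "cmod z = 1" by simp
      from fourier_exp_1_surj[OF b this, of c] obtain y where y: "y \<in> ?I" "fourier_exp b 1 y = z"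
        by (elim bexE)
      have "f y \<in> B" using z p[OF y(1)] y(2) by simp
      then show "z \<in> fourier_exp b 1 ` (f -` B \<inter> ?I)"
        using y by (intro image_eqI[of _ _ y]) simp_all
    qed (use p in auto)
    moreover have "closed (f -` B \<inter> ?I)"
      by (rule continuous_on_closed_vimage[THEN iffD1, rule_format, OF _ f(1) \<open>closed B\<close>]) simp
    then have "compact (f -` B \<inter> ?I)"
      using closed_Int_compact[of "f -` B \<inter> ?I" ?I] by (simp add: Int_assoc)
    then have "compact (fourier_exp b 1 ` (f -` B \<inter> ?I))"
      by (intro compact_continuous_image continuous_on_fourier_exp)
    ultimately show "closed (p -` B \<inter> sphere 0 1)" by (simp add: compact_imp_closed)
  qed
  then show ?thesis using p by (rule that)
qed

lemma trig_poly_uniform_approx: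
  fixes f :: "real \<Rightarrow> complex"
  assumes b: "b > 0" and f: "continuous_on {c..c + 1 / b} f" "f c = f (c + 1 / b)" and e: "0 < e"
  obtains g where "trig_poly b g" "\<And>y. y \<in> {c..c + 1 / b} \<Longrightarrow> cmod (f y - g y) < e"
proof -
  obtain p where p: "continuous_on (sphere 0 1) p" "\<And>y. y \<in> {c..c + 1 / b} \<Longrightarrow> p (fourier_exp b 1 y) = f y"
    using periodic_factors_through_circle[OF b f] by blast
  obtain g where "polynomial_function g" "\<forall>z\<in>sphere 0 1. cmod (p z - g z) < e"
    using Stone_Weierstrass_polynomial_function[OF compact_sphere p(1) e] by blast
  then have "trig_poly b (\<lambda>y. g (fourier_exp b 1 y))"
    "\<And>y. y \<in> {c..c + 1 / b} \<Longrightarrow> cmod (f y - g (fourier_exp b 1 y)) < e"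
    using trig_poly_polynomial p(2)[symmetric] by auto
  then show ?thesis by (rule that)
qed

subsection \<open>Parseval on an interval\<close>

lemma norm_add_sq_le:
  fixes x y :: complex
  shows "(cmod (x + y))\<^sup>2 \<le> 2 * (cmod x)\<^sup>2 + 2 * (cmod y)\<^sup>2"
proof -
  have "(cmod (x + y))\<^sup>2 \<le> (cmod x + cmod y)\<^sup>2"
    by (intro power_mono norm_triangle_ineq) auto
  also have "\<dots> \<le> 2 * (cmod x)\<^sup>2 + 2 * (cmod y)\<^sup>2"
    using sum_squares_bound[of "cmod x" "cmod y"] by (simp add: power2_sum)
  finally show ?thesis .
qed

lemma integrable_norm_add_sq:
  fixes f g :: "'a \<Rightarrow> complex"
  assumes "f \<in> borel_measurable M" "integrable M (\<lambda>x. (cmod (f x))\<^sup>2)"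
    and "g \<in> borel_measurable M" "integrable M (\<lambda>x. (cmod (g x))\<^sup>2)"
  shows "integrable M (\<lambda>x. (cmod (f x + g x))\<^sup>2)"
proof (rule Bochner_Integration.integrable_bound)
  show "integrable M (\<lambda>x. 2 * (cmod (f x))\<^sup>2 + 2 * (cmod (g x))\<^sup>2)" using assms by simp
  show "AE x in M. norm ((cmod (f x + g x))\<^sup>2) \<le> norm (2 * (cmod (f x))\<^sup>2 + 2 * (cmod (g x))\<^sup>2)"
    by (intro AE_I2) (simp add: norm_add_sq_le)
qed (use assms in measurable)

lemma integral_norm_add_sq_le:
  fixes f g :: "'a \<Rightarrow> complex"
  assumes "f \<in> borel_measurable M" "integrable M (\<lambda>x. (cmod (f x))\<^sup>2)"
    and "g \<in> borel_measurable M" "integrable M (\<lambda>x. (cmod (g x))\<^sup>2)"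
  shows "(\<integral>x. (cmod (f x + g x))\<^sup>2 \<partial>M) \<le> 2 * (\<integral>x. (cmod (f x))\<^sup>2 \<partial>M) + 2 * (\<integral>x. (cmod (g x))\<^sup>2 \<partial>M)"
proof -
  have "(\<integral>x. (cmod (f x + g x))\<^sup>2 \<partial>M) \<le> (\<integral>x. 2 * (cmod (f x))\<^sup>2 + 2 * (cmod (g x))\<^sup>2 \<partial>M)"
    using assms integrable_norm_add_sq[OF assms] by (intro integral_mono norm_add_sq_le) auto
  then show ?thesis using assms by simp
qed

lemma (in finite_measure) integrable_of_square_integrable:
  fixes f g :: "'a \<Rightarrow> complex"
  assumes f: "f \<in> borel_measurable M" "integrable M (\<lambda>x. (cmod (f x))\<^sup>2)"
    and g: "g \<in> borel_measurable M" "\<And>x. cmod (g x) \<le> 1"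
  shows "integrable M (\<lambda>x. f x * g x)"
proof (rule Bochner_Integration.integrable_bound)
  show "integrable M (\<lambda>x. 1 + (cmod (f x))\<^sup>2)" using f by simp
  show "AE x in M. norm (f x * g x) \<le> norm (1 + (cmod (f x))\<^sup>2)"
  proof (intro AE_I2)
    fix x
    have "norm (f x * g x) \<le> cmod (f x) * 1"
      unfolding norm_mult using g by (intro mult_left_mono) auto
    also have "\<dots> \<le> 1 + (cmod (f x))\<^sup>2"
      using sum_squares_bound[of 1 "cmod (f x)"] by (simp add: power2_eq_square) (smt (verit) norm_ge_zero zero_le_mult_iff)
    finally show "norm (f x * g x) \<le> norm (1 + (cmod (f x))\<^sup>2)" by simp
  qed
qed (use f g in measurable)

lemma truncation_L2_limit:
  fixes f :: "'a \<Rightarrow> complex"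
  assumes f: "f \<in> borel_measurable M" "integrable M (\<lambda>x. (cmod (f x))\<^sup>2)"
  shows "(\<lambda>n. \<integral>x. (cmod (f x - (if cmod (f x) \<le> real n then f x else 0)))\<^sup>2 \<partial>M) \<longlonglongrightarrow> 0"
proof -
  have "(\<lambda>n. \<integral>x. (cmod (f x - (if cmod (f x) \<le> real n then f x else 0)))\<^sup>2 \<partial>M) \<longlonglongrightarrow> (\<integral>x. 0 \<partial>M)"
  proof (rule integral_dominated_convergence[where w = "\<lambda>x. (cmod (f x))\<^sup>2"])
    show "AE x in M. (\<lambda>n. (cmod (f x - (if cmod (f x) \<le> real n then f x else 0)))\<^sup>2) \<longlonglongrightarrow> 0"
    proof (intro AE_I2 tendsto_eventually)
      fix x
      obtain n0 where n0: "cmod (f x) \<le> real n0" using real_arch_simple by blast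
      show "\<forall>\<^sub>F n in sequentially. (cmod (f x - (if cmod (f x) \<le> real n then f x else 0)))\<^sup>2 = 0"
        using eventually_ge_at_top[of n0] by eventually_elim (use n0 in auto)
    qed
  qed (use f in auto)
  then show ?thesis by simp
qed

text \<open>Measurability supplies continuous functions converging to \<open>f\<close> off a
  negligible set. Projecting their values to the ball of radius \<open>B\<close> provides a
  dominating constant, and the cut-off \<open>cut\<close> forces zero endpoint values, so that the
  approximants extend periodically.\<close>

lemma continuous_L2_approx_bounded:
  fixes f :: "real \<Rightarrow> complex"
  assumes cd: "c < d" and f: "f \<in> borel_measurable (lebesgue_on {c..d})" and B: "0 \<le> B" "\<And>x. cmod (f x) \<le> B" and e: "0 < e"
  shows "\<exists>h. continuous_on {c..d} h \<and> h c = 0 \<and> h d = 0 \<and>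
    (\<integral>x. (cmod (f x - h x))\<^sup>2 \<partial>lebesgue_on {c..d}) < e"
proof -
  let ?M = "lebesgue_on {c..d}"
  interpret finite_measure ?M by (rule finite_measure_lebesgue_on) auto
  have "(\<lambda>x. if x \<in> {c..d} then f x else 0) \<in> borel_measurable lebesgue"
    using f by (subst borel_measurable_if) auto
  then have "(\<lambda>x. if x \<in> {c..d} then f x else 0) measurable_on UNIV"
    by (rule lebesgue_measurable_imp_measurable_on) simp
  then obtain N g where N: "negligible N" and g: "\<And>n. continuous_on UNIV (g n)"
    and lim: "\<And>x. x \<notin> N \<Longrightarrow> (\<lambda>n. g n x) \<longlonglongrightarrow> (if x \<in> {c..d} then f x else 0)"
    unfolding measurable_on_def by auto
  define cut where "cut n x = min 1 (real n * (x - c)) * min 1 (real n * (d - x))" for n x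
  define h where "h n x = of_real (cut n x) * closest_point (cball 0 B) (g n x)" for n x
  have cont_cp: "continuous_on S (closest_point (cball (0::complex) B))" for S
    using B(1) by (intro continuous_on_closest_point) auto
  have cp: "cmod (closest_point (cball 0 B) z) \<le> B" for z :: complex
    using closest_point_in_set[of "cball (0::complex) B" z] B(1) by auto
  have cont: "continuous_on S (h n)" for S n
  proof -
    have "continuous_on S (\<lambda>x. closest_point (cball 0 B) (g n x))"
      by (rule continuous_on_compose2[OF cont_cp[of UNIV] continuous_on_subset[OF g]]) auto
    then show ?thesis unfolding h_def cut_def by (intro continuous_intros)
  qed
  have cut01: "\<bar>cut n x\<bar> \<le> 1" if "x \<in> {c..d}" for n x
  proof -
    have "\<bar>min 1 (real n * (x - c))\<bar> \<le> 1" "\<bar>min 1 (real n * (d - x))\<bar> \<le> 1" using that by auto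
    then show ?thesis unfolding cut_def abs_mult by (intro mult_le_one) auto
  qed
  have hB: "cmod (h n x) \<le> B" if "x \<in> {c..d}" for n x
  proof -
    have "cmod (h n x) \<le> 1 * B"
      unfolding h_def norm_mult norm_of_real using cut01[OF that] cp B(1) by (intro mult_mono) auto
    then show ?thesis by simp
  qed
  have "(\<lambda>n. \<integral>x. (cmod (f x - h n x))\<^sup>2 \<partial>?M) \<longlonglongrightarrow> (\<integral>x. 0 \<partial>?M)"
  proof (rule integral_dominated_convergence[where w = "\<lambda>x. (2 * B)\<^sup>2"])
    show "AE x in ?M. (\<lambda>n. (cmod (f x - h n x))\<^sup>2) \<longlonglongrightarrow> 0"
    proof (rule AE_I'[of "(N \<union> {c, d}) \<inter> {c..d}"])
      have "N \<union> {c, d} \<in> null_sets lebesgue"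
        using N negligible_iff_null_sets by (metis negligible_Un negligible_finite finite.emptyI finite_insert)
      then show "(N \<union> {c, d}) \<inter> {c..d} \<in> null_sets ?M"
        by (subst null_sets_restrict_space) (simp_all add: null_set_Int2)
      show "{x \<in> space ?M. \<not> (\<lambda>n. (cmod (f x - h n x))\<^sup>2) \<longlonglongrightarrow> 0} \<subseteq> (N \<union> {c, d}) \<inter> {c..d}"
      proof (rule ccontr)
        assume "\<not> ?thesis"
        then obtain x where x: "x \<in> {c..d}" "x \<notin> N" "x \<noteq> c" "x \<noteq> d"
          and nl: "\<not> (\<lambda>n. (cmod (f x - h n x))\<^sup>2) \<longlonglongrightarrow> 0" by auto
        have "(\<lambda>n. closest_point (cball 0 B) (g n x)) \<longlonglongrightarrow> closest_point (cball 0 B) (f x)"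
          using lim[OF x(2)] x(1) cont_cp[of UNIV] continuous_on_tendsto_compose by fastforce
        moreover have "closest_point (cball 0 B) (f x) = f x" by (rule closest_point_self) (simp add: B)
        moreover have "(\<lambda>n. complex_of_real (cut n x)) \<longlonglongrightarrow> 1"
        \<comment> \<open>At an interior point both ramps have reached height one as soon as
          \<open>n\<close> exceeds the reciprocal distances to the endpoints.\<close>
        proof (rule tendsto_eventually)
          obtain n1 where n1: "1 / (x - c) \<le> real n1" using real_arch_simple by blast
          obtain n2 where n2: "1 / (d - x) \<le> real n2" using real_arch_simple by blast
          show "\<forall>\<^sub>F n in sequentially. complex_of_real (cut n x) = 1"
            using eventually_ge_at_top[of "max n1 n2"]
          proof eventually_elim
            case (elim n)
            then have "1 / (x - c) \<le> real n" "1 / (d - x) \<le> real n" using n1 n2 by linarith+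
            then have "1 \<le> real n * (x - c)" "1 \<le> real n * (d - x)"
              using x by (auto simp: field_simps)
            then show ?case by (simp add: cut_def)
          qed
        qed
        ultimately have "(\<lambda>n. h n x) \<longlonglongrightarrow> 1 * f x" unfolding h_def by (intro tendsto_mult) auto
        then have "(\<lambda>n. (cmod (f x - h n x))\<^sup>2) \<longlonglongrightarrow> (cmod (f x - 1 * f x))\<^sup>2" by (intro tendsto_intros)
        then show False using nl by simp
      qed
    qed
    show "AE x in ?M. norm ((cmod (f x - h n x))\<^sup>2) \<le> (2 * B)\<^sup>2" for n
    proof (intro AE_I2)
      fix x assume "x \<in> space ?M"
      then have "cmod (f x - h n x) \<le> 2 * B"
        using hB[of x n] B(2)[of x] norm_triangle_ineq4[of "f x" "h n x"] by simp
      then have "(cmod (f x - h n x))\<^sup>2 \<le> (2 * B)\<^sup>2" by (intro power_mono) auto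
      then show "norm ((cmod (f x - h n x))\<^sup>2) \<le> (2 * B)\<^sup>2" by (simp only: real_norm_def abs_power2)
    qed
    show "(\<lambda>x. (cmod (f x - h n x))\<^sup>2) \<in> borel_measurable ?M" for n
      using f continuous_imp_measurable_on_sets_lebesgue[OF cont[of "{c..d}" n]] by simp
  qed auto
  then have "\<forall>\<^sub>F n in sequentially. (\<integral>x. (cmod (f x - h n x))\<^sup>2 \<partial>?M) < e"
    using e by (intro order_tendstoD(2)[of _ 0]) auto
  then obtain n where "(\<integral>x. (cmod (f x - h n x))\<^sup>2 \<partial>?M) < e"
    by (auto simp: eventually_sequentially)
  moreover have "h n c = 0" "h n d = 0" using cd by (auto simp: h_def cut_def)
  ultimately show ?thesis using cont by blast
qed

lemma borel_measurable_continuous_lebesgue_on: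
  fixes h :: "real \<Rightarrow> complex"
  assumes "continuous_on {c..d} h"
  shows "h \<in> borel_measurable (lebesgue_on {c..d})"
    and "integrable (lebesgue_on {c..d}) (\<lambda>x. (cmod (h x))\<^sup>2)"
proof -
  show "h \<in> borel_measurable (lebesgue_on {c..d})"
    using assms by (rule continuous_imp_measurable_on_sets_lebesgue) simp
  show "integrable (lebesgue_on {c..d}) (\<lambda>x. (cmod (h x))\<^sup>2)"
    using assms by (intro continuous_imp_integrable_real continuous_intros)
qed

lemma trig_poly_L2_dense:
  fixes f :: "real \<Rightarrow> complex"
  assumes b: "b > 0" and f: "f \<in> borel_measurable (lebesgue_on {c..c + 1 / b})"
    "integrable (lebesgue_on {c..c + 1 / b}) (\<lambda>x. (cmod (f x))\<^sup>2)" and e: "0 < e"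
  shows "\<exists>g. trig_poly b g \<and> continuous_on {c..c + 1 / b} g \<and> (\<integral>x. (cmod (f x - g x))\<^sup>2 \<partial>lebesgue_on {c..c + 1 / b}) < e"
proof -
  let ?I = "{c..c + 1 / b}"
  let ?M = "lebesgue_on ?I"
  interpret finite_measure ?M by (rule finite_measure_lebesgue_on) auto
  define T where "T n x = (if cmod (f x) \<le> real n then f x else 0)" for n x
  have "\<forall>\<^sub>F n in sequentially. (\<integral>x. (cmod (f x - T n x))\<^sup>2 \<partial>?M) < e / 8"
    using e truncation_L2_limit[OF f] unfolding T_def by (intro order_tendstoD(2)[of _ 0]) auto
  then obtain n where n: "(\<integral>x. (cmod (f x - T n x))\<^sup>2 \<partial>?M) < e / 8"
    by (auto simp: eventually_sequentially)
  have Tm: "T n \<in> borel_measurable ?M" unfolding T_def using f(1) by measurable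
  have Tb: "cmod (T n x) \<le> real n" for x by (simp add: T_def)
  have cd: "c < c + 1 / b" using b by simp
  obtain h where h: "continuous_on ?I h" "h c = 0" "h (c + 1 / b) = 0"
    and hT: "(\<integral>x. (cmod (T n x - h x))\<^sup>2 \<partial>?M) < e / 16"
    using continuous_L2_approx_bounded[OF cd Tm of_nat_0_le_iff Tb, of "e / 16"] e by auto
  \<comment> \<open>A uniform error \<open>\<delta>\<close> on a period of length
    \<open>1 / b\<close> costs \<open>e / 16\<close> in squared norm. Each triangle step doubles the
    errors: \<open>e / 16\<close> twice gives \<open>e / 4\<close>, and \<open>e / 8\<close> with
    \<open>e / 4\<close> stays below \<open>e\<close>.\<close>
  define \<delta> where "\<delta> = sqrt (e * b / 16)"
  have \<delta>: "0 < \<delta>" "\<delta>\<^sup>2 = e * b / 16" using e b by (auto simp: \<delta>_def)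
  obtain g where g: "trig_poly b g" "\<And>y. y \<in> ?I \<Longrightarrow> cmod (h y - g y) < \<delta>"
    using trig_poly_uniform_approx[OF b h(1) _ \<delta>(1)] h(2,3) by auto
  have gc: "continuous_on ?I g"
    using g(1) by induction (auto intro!: continuous_intros)
  note hm = borel_measurable_continuous_lebesgue_on[OF h(1)]
  note gm = borel_measurable_continuous_lebesgue_on[OF gc]
  note hgm = borel_measurable_continuous_lebesgue_on[OF continuous_on_diff[OF h(1) gc]]
  have "(\<integral>x. (cmod (h x - g x))\<^sup>2 \<partial>?M) \<le> (\<integral>x. \<delta>\<^sup>2 \<partial>?M)"
    using g(2) hgm by (intro integral_mono power_mono) (auto intro: less_imp_le)
  also have "\<dots> = e / 16" using b by (simp add: \<delta>(2) measure_restrict_space)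
  finally have hg: "(\<integral>x. (cmod (h x - g x))\<^sup>2 \<partial>?M) \<le> e / 16" .
  have Ti: "integrable ?M (\<lambda>x. (cmod (T n x))\<^sup>2)"
  proof (rule Bochner_Integration.integrable_bound[OF f(2)])
    show "AE x in ?M. norm ((cmod (T n x))\<^sup>2) \<le> norm ((cmod (f x))\<^sup>2)" by (simp add: T_def)
  qed (use Tm in measurable)
  have sq_diff: "integrable ?M (\<lambda>x. (cmod (u x - v x))\<^sup>2)"
    if "u \<in> borel_measurable ?M" "integrable ?M (\<lambda>x. (cmod (u x))\<^sup>2)"
      "v \<in> borel_measurable ?M" "integrable ?M (\<lambda>x. (cmod (v x))\<^sup>2)" for u v :: "real \<Rightarrow> complex"
    using integrable_norm_add_sq[OF that(1,2), of "\<lambda>x. - v x"] that(3,4) by simp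
  have tri: "(\<integral>x. (cmod (u x - w x))\<^sup>2 \<partial>?M) \<le> 2 * (\<integral>x. (cmod (u x - v x))\<^sup>2 \<partial>?M) + 2 * (\<integral>x. (cmod (v x - w x))\<^sup>2 \<partial>?M)"
    if "u \<in> borel_measurable ?M" "integrable ?M (\<lambda>x. (cmod (u x))\<^sup>2)"
      "v \<in> borel_measurable ?M" "integrable ?M (\<lambda>x. (cmod (v x))\<^sup>2)"
      "w \<in> borel_measurable ?M" "integrable ?M (\<lambda>x. (cmod (w x))\<^sup>2)" for u v w :: "real \<Rightarrow> complex"
    using integral_norm_add_sq_le[of "\<lambda>x. u x - v x" ?M "\<lambda>x. v x - w x"] that sq_diff by simp
  have "(\<integral>x. (cmod (T n x - g x))\<^sup>2 \<partial>?M) < e / 4"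
    using tri[OF Tm Ti hm gm] hT hg by linarith
  then have "(\<integral>x. (cmod (f x - g x))\<^sup>2 \<partial>?M) < e"
    using tri[OF f Tm Ti gm] n e by linarith
  then show ?thesis using g(1) gc by blast
qed

section \<open>Orthogonality of the exponentials and the Parseval identity\<close>

lemma integrable_fourier_exp: "integrable (lebesgue_on {c..c + 1 / b}) (fourier_exp b l)"
proof -
  interpret finite_measure "lebesgue_on {c..c + 1 / b}" by (rule finite_measure_lebesgue_on) auto
  show ?thesis
    by (rule integrable_const_bound[where B = 1])
      (auto intro: borel_measurable_continuous_lebesgue_on continuous_on_fourier_exp)
qed

lemma integral_fourier_exp:
  assumes b: "b > 0"
  shows "(\<integral>y. fourier_exp b l y * cnj (fourier_exp b m y) \<partial>lebesgue_on {c..c + 1 / b}) = (if l = m then of_real (1 / b) else 0)"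
proof -
  let ?I = "{c..c + 1 / b}"
  have e: "fourier_exp b l y * cnj (fourier_exp b m y) = fourier_exp b (l - m) y" for y
    unfolding cnj_fourier_exp fourier_exp_add[symmetric] by simp
  show ?thesis
  proof (cases "l = m")
    case True
    then show ?thesis unfolding e using b by (simp add: measure_restrict_space scaleR_conv_of_real)
  next
    case False
    define k where "k = \<i> * complex_of_real (2 * pi * (of_int (l - m) * b))"
    have k0: "k \<noteq> 0" using False b by (simp add: k_def)
    have fe: "fourier_exp b (l - m) y = exp (k * of_real y)" for y
      by (simp add: fourier_exp_def k_def mult_ac)
    have der: "((\<lambda>y. exp (k * of_real y) / k) has_vector_derivative exp (k * of_real y)) (at y within ?I)" for y
    proof -
      have "((\<lambda>z. exp (k * z) / k) has_field_derivative exp (k * of_real y)) (at (of_real y))"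
        using k0 by (auto intro!: derivative_eq_intros)
      from has_vector_derivative_real_field[OF this] show ?thesis
        by (simp add: has_vector_derivative_at_within)
    qed
    have "((\<lambda>y. exp (k * of_real y)) has_integral (exp (k * of_real (c + 1 / b)) / k - exp (k * of_real c) / k)) ?I"
      using b der by (intro fundamental_theorem_of_calculus) auto
    moreover have "exp (k * of_real (c + 1 / b)) = exp (k * of_real c)"
      using fourier_exp_periodic[OF b, of "l - m" c 1] unfolding fe by simp
    ultimately have "integral ?I (\<lambda>y. exp (k * of_real y)) = 0" by (simp add: integral_unique)
    moreover have "integrable (lebesgue_on ?I) (\<lambda>y. exp (k * of_real y))"
      using integrable_fourier_exp[of c b "l - m"] fe by (simp cong: Bochner_Integration.integrable_cong)
    ultimately show ?thesis
      using False lebesgue_integral_eq_integral[of ?I "\<lambda>y. exp (k * of_real y)"] by (simp add: e fe)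
  qed
qed

text \<open>Left unnormalised so that it equals the inner product with a Gabor atom; the factor
  \<open>1 / b\<close> then appears in Parseval. The base point \<open>c\<close> is free, since
  different fibres are later integrated over different periods.\<close>

definition fourier_coeff :: "real \<Rightarrow> real \<Rightarrow> (real \<Rightarrow> complex) \<Rightarrow> int \<Rightarrow> complex" where
  "fourier_coeff b c f l = (\<integral>y. f y * cnj (fourier_exp b l y) \<partial>lebesgue_on {c..c + 1 / b})"

text \<open>Completing the square. The coefficients \<open>b * fourier_coeff b c f l\<close> are
  optimal: inserting them gives Bessel's inequality, and dropping the last nonnegative term bounds
  the defect by the error of any trigonometric polynomial.\<close>

lemma fourier_approx_error:
  fixes f :: "real \<Rightarrow> complex"
  assumes b: "b > 0" and f: "f \<in> borel_measurable (lebesgue_on {c..c + 1 / b})"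
    "integrable (lebesgue_on {c..c + 1 / b}) (\<lambda>x. (cmod (f x))\<^sup>2)" and L: "finite L"
  shows "(\<integral>x. (cmod (f x - (\<Sum>l\<in>L. a l * fourier_exp b l x)))\<^sup>2 \<partial>lebesgue_on {c..c + 1 / b})
    = (\<integral>x. (cmod (f x))\<^sup>2 \<partial>lebesgue_on {c..c + 1 / b}) - b * (\<Sum>l\<in>L. (cmod (fourier_coeff b c f l))\<^sup>2)
      + (\<Sum>l\<in>L. (cmod (a l - b * fourier_coeff b c f l))\<^sup>2) / b"
proof -
  let ?M = "lebesgue_on {c..c + 1 / b}"
  let ?e = "fourier_exp b"
  let ?c = "fourier_coeff b c f"
  interpret finite_measure ?M by (rule finite_measure_lebesgue_on) auto
  have em: "?e l \<in> borel_measurable ?M" for l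
    by (rule borel_measurable_continuous_lebesgue_on) (intro continuous_intros)
  have fe: "integrable ?M (\<lambda>y. f y * cnj (?e l y))" for l
    using integrable_of_square_integrable[OF f em, of "- l"] by (simp add: cnj_fourier_exp)
  have ee: "integrable ?M (\<lambda>y. ?e l y * cnj (?e m y))" for l m
    using integrable_fourier_exp[of c b "l - m"]
    unfolding cnj_fourier_exp fourier_exp_add[symmetric] by simp
  have ff: "integrable ?M (\<lambda>y. complex_of_real ((cmod (f y))\<^sup>2))" using f(2) by (rule integrable_of_real)
  have "complex_of_real (\<integral>x. (cmod (f x - (\<Sum>l\<in>L. a l * ?e l x)))\<^sup>2 \<partial>?M)
     = (\<integral>x. complex_of_real ((cmod (f x - (\<Sum>l\<in>L. a l * ?e l x)))\<^sup>2) \<partial>?M)"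
    by (rule integral_complex_of_real[symmetric])
  also have "\<dots> = (\<integral>x. complex_of_real ((cmod (f x))\<^sup>2) - (\<Sum>l\<in>L. cnj (a l) * (f x * cnj (?e l x)))
      - (\<Sum>l\<in>L. a l * cnj (f x * cnj (?e l x))) + (\<Sum>l\<in>L. \<Sum>m\<in>L. (a l * cnj (a m)) * (?e l x * cnj (?e m x))) \<partial>?M)"
  proof (rule Bochner_Integration.integral_cong[OF refl])
    fix x
    have "complex_of_real ((cmod (f x - (\<Sum>l\<in>L. a l * ?e l x)))\<^sup>2)
      = (f x - (\<Sum>l\<in>L. a l * ?e l x)) * (cnj (f x) - (\<Sum>l\<in>L. cnj (a l) * cnj (?e l x)))"
      unfolding complex_norm_square by (simp add: cnj_sum)
    also have "\<dots> = f x * cnj (f x) - f x * (\<Sum>l\<in>L. cnj (a l) * cnj (?e l x)) - (\<Sum>l\<in>L. a l * ?e l x) * cnj (f x)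
       + (\<Sum>l\<in>L. a l * ?e l x) * (\<Sum>m\<in>L. cnj (a m) * cnj (?e m x))" by algebra
    also have "(\<Sum>l\<in>L. a l * ?e l x) * (\<Sum>m\<in>L. cnj (a m) * cnj (?e m x))
       = (\<Sum>l\<in>L. \<Sum>m\<in>L. (a l * ?e l x) * (cnj (a m) * cnj (?e m x)))" by (rule sum_product)
    finally show "complex_of_real ((cmod (f x - (\<Sum>l\<in>L. a l * ?e l x)))\<^sup>2) = complex_of_real ((cmod (f x))\<^sup>2)
      - (\<Sum>l\<in>L. cnj (a l) * (f x * cnj (?e l x)))
      - (\<Sum>l\<in>L. a l * cnj (f x * cnj (?e l x))) + (\<Sum>l\<in>L. \<Sum>m\<in>L. (a l * cnj (a m)) * (?e l x * cnj (?e m x)))"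
      unfolding complex_norm_square
      by (simp add: sum_distrib_left sum_distrib_right mult_ac)
  qed
  also have "\<dots> = complex_of_real (\<integral>x. (cmod (f x))\<^sup>2 \<partial>?M) - (\<Sum>l\<in>L. cnj (a l) * ?c l)
      - (\<Sum>l\<in>L. a l * cnj (?c l)) + (\<Sum>l\<in>L. \<Sum>m\<in>L. (a l * cnj (a m)) * (if l = m then of_real (1 / b) else 0))"
    using ff fe ee integrable_cnj[OF fe]
    by (simp add: fourier_coeff_def integral_fourier_exp[OF b] del: complex_cnj_mult of_real_power flip: integral_cnj)
  also have "(\<Sum>l\<in>L. \<Sum>m\<in>L. (a l * cnj (a m)) * (if l = m then of_real (1 / b) else 0)) = (\<Sum>l\<in>L. a l * cnj (a l) / b)"
    using L by (intro sum.cong refl) (simp add: if_distrib[of "\<lambda>x. _ * x"] cong: if_cong)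
  also have "complex_of_real (\<integral>x. (cmod (f x))\<^sup>2 \<partial>?M) - (\<Sum>l\<in>L. cnj (a l) * ?c l) - (\<Sum>l\<in>L. a l * cnj (?c l)) + (\<Sum>l\<in>L. a l * cnj (a l) / b)
    = complex_of_real (\<integral>x. (cmod (f x))\<^sup>2 \<partial>?M)
      + (\<Sum>l\<in>L. (a l - b * ?c l) * cnj (a l - b * ?c l) / b - b * (?c l * cnj (?c l)))"
  proof -
    have "(a l - b * ?c l) * cnj (a l - b * ?c l) / b - b * (?c l * cnj (?c l))
      = a l * cnj (a l) / b - cnj (a l) * ?c l - a l * cnj (?c l)" for l
      using b by (simp add: field_simps)
    then show ?thesis by (simp add: sum_subtractf)
  qed
  also have "\<dots> = complex_of_real ((\<integral>x. (cmod (f x))\<^sup>2 \<partial>?M)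
      + (\<Sum>l\<in>L. (cmod (a l - b * ?c l))\<^sup>2 / b - b * (cmod (?c l))\<^sup>2))"
    unfolding complex_norm_square[symmetric] by simp
  finally show ?thesis
    unfolding of_real_eq_iff by (simp add: sum_subtractf sum_distrib_left sum_divide_distrib)
qed

text \<open>Bessel bounds every finite partial sum, and density of trigonometric polynomials
  produces finite sums arbitrarily close to that bound. As the terms are nonnegative, the supremum
  is the unconditional sum.\<close>

theorem parseval:
  fixes f :: "real \<Rightarrow> complex"
  assumes b: "b > 0" and f: "f \<in> borel_measurable (lebesgue_on {c..c + 1 / b})"
    "integrable (lebesgue_on {c..c + 1 / b}) (\<lambda>x. (cmod (f x))\<^sup>2)"
  shows "((\<lambda>l. (cmod (fourier_coeff b c f l))\<^sup>2) has_sum (\<integral>x. (cmod (f x))\<^sup>2 \<partial>lebesgue_on {c..c + 1 / b}) / b) UNIV"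
proof -
  let ?M = "lebesgue_on {c..c + 1 / b}"
  let ?c = "\<lambda>l. (cmod (fourier_coeff b c f l))\<^sup>2"
  let ?F = "\<integral>x. (cmod (f x))\<^sup>2 \<partial>?M"
  note err = fourier_approx_error[OF b f]
  have bessel: "b * sum ?c L \<le> ?F" if "finite L" for L
  proof -
    have "0 \<le> (\<integral>x. (cmod (f x - (\<Sum>l\<in>L. (b * fourier_coeff b c f l) * fourier_exp b l x)))\<^sup>2 \<partial>?M)" by simp
    then show ?thesis unfolding err[OF that] by simp
  qed
  then have ub: "sum ?c L \<le> ?F / b" if "finite L" for L using that b by (simp add: field_simps)
  have "\<exists>L. finite L \<and> ?F / b - e < sum ?c L" if "0 < e" for e
  proof -
    have "0 < e * b" using that b by simp
    then obtain g where "trig_poly b g" and g: "(\<integral>x. (cmod (f x - g x))\<^sup>2 \<partial>?M) < e * b"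
      using trig_poly_L2_dense[OF b f] by blast
    then obtain L a where L: "finite L" and gL: "g = (\<lambda>y. \<Sum>l\<in>L. a l * fourier_exp b l y)"
      using trig_poly_expansion by blast
    have "0 \<le> (\<Sum>l\<in>L. (cmod (a l - b * fourier_coeff b c f l))\<^sup>2) / b" using b by (intro divide_nonneg_pos sum_nonneg) auto
    then have "?F - b * sum ?c L < e * b" using g unfolding gL err[OF L] by linarith
    then have "?F / b - e < sum ?c L" using b by (simp add: field_simps)
    then show ?thesis using L by blast
  qed
  note lb = this
  show ?thesis
    unfolding has_sum_def
  proof (rule order_tendstoI)
    fix e :: real assume "e < ?F / b"
    then obtain L where L: "finite L" "e < sum ?c L" using lb[of "?F / b - e"] by auto
    show "\<forall>\<^sub>F K in finite_subsets_at_top UNIV. e < sum ?c K"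
      unfolding eventually_finite_subsets_at_top
    proof (intro exI[of _ L] conjI allI impI L(1))
      fix K :: "int set" assume "finite K \<and> L \<subseteq> K \<and> K \<subseteq> UNIV"
      then have "sum ?c L \<le> sum ?c K" by (intro sum_mono2) auto
      then show "e < sum ?c K" using L(2) by linarith
    qed simp
  next
    fix e :: real assume e: "?F / b < e"
    show "\<forall>\<^sub>F K in finite_subsets_at_top UNIV. sum ?c K < e"
      unfolding eventually_finite_subsets_at_top
    proof (intro exI[of _ "{}"] conjI allI impI)
      fix K :: "int set" assume "finite K \<and> {} \<subseteq> K \<and> K \<subseteq> UNIV"
      then show "sum ?c K < e" using ub e by (meson le_less_trans)
    qed auto
  qed
qed

subsection \<open>Fibres of the Gabor coefficients\<close>

lemma integrable_translate:
  fixes h :: "real \<Rightarrow> 'a::euclidean_space"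
  shows "integrable lebesgue h \<Longrightarrow> integrable lebesgue (\<lambda>y. h (y + t))"
  using lebesgue_integrable_real_affine[of h 1 t] by (simp add: add.commute)

lemma measurable_translate:
  fixes h :: "real \<Rightarrow> 'a::euclidean_space"
  assumes "h \<in> borel_measurable lebesgue"
  shows "(\<lambda>y. h (y + t)) \<in> borel_measurable lebesgue"
  using borel_measurable_affine[of h 1 t] assms by (simp add: add.commute)

lemma lebesgue_on_measurable:
  "h \<in> borel_measurable lebesgue \<Longrightarrow> h \<in> borel_measurable (lebesgue_on S)"
  by (rule measurable_restrict_space1)

lemma lebesgue_on_integrable:
  fixes h :: "real \<Rightarrow> 'a::euclidean_space"
  assumes "integrable lebesgue h"
  shows "integrable (lebesgue_on {c..d}) h"
  using integrable_mult_indicator[OF _ assms, of "{c..d}"] by (simp add: integrable_restrict_space)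

lemma integral_lebesgue_on_half_open:
  fixes h :: "real \<Rightarrow> 'a::euclidean_space"
  assumes "integrable lebesgue h"
  shows "(\<integral>y. h y \<partial>lebesgue_on {c..d}) = (\<integral>y. indicator {c..<d} y *\<^sub>R h y \<partial>lebesgue)"
proof -
  have m: "h \<in> borel_measurable lebesgue" using assms by simp
  have "(\<integral>y. h y \<partial>lebesgue_on {c..d}) = (\<integral>y. indicator {c..d} y *\<^sub>R h y \<partial>lebesgue)"
    by (rule integral_restrict_space) simp
  also have "\<dots> = (\<integral>y. indicator {c..<d} y *\<^sub>R h y \<partial>lebesgue)"
  proof (rule integral_cong_AE)
    show "AE y in lebesgue. indicator {c..d} y *\<^sub>R h y = indicator {c..<d} y *\<^sub>R h y"
    proof (rule AE_I'[of "{d}"])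
      show "{y \<in> space lebesgue. indicator {c..d} y *\<^sub>R h y \<noteq> indicator {c..<d} y *\<^sub>R h y} \<subseteq> {d}"
        by (auto simp: indicator_def)
    qed (use negligible_iff_null_sets negligible_sing in blast)
  qed (use m in \<open>auto intro!: borel_measurable_scaleR borel_measurable_indicator\<close>)
  finally show ?thesis .
qed

text \<open>The half-open cells of length \<open>s\<close> partition the line and each is translated
  to the base period; the closed period differs from it by a null set. Finiteness of
  \<open>J\<close> lets sum and integral be exchanged freely.\<close>

lemma integral_periodize:
  fixes h :: "real \<Rightarrow> 'a::euclidean_space"
  assumes s: "s > 0" and h: "integrable lebesgue h" and J: "finite J"
    "\<And>x. h x \<noteq> 0 \<Longrightarrow> \<lfloor>(x - c) / s\<rfloor> \<in> J"
  shows "(\<integral>x. h x \<partial>lebesgue) = (\<integral>y. (\<Sum>n\<in>J. h (y + of_int n * s)) \<partial>lebesgue_on {c..c + s})"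
proof -
  let ?P = "\<lambda>n::int. {c + of_int n * s..<c + of_int n * s + s}"
  have P: "x \<in> ?P n \<longleftrightarrow> n = \<lfloor>(x - c) / s\<rfloor>" for x n
  proof -
    have "n = \<lfloor>(x - c) / s\<rfloor> \<longleftrightarrow> of_int n \<le> (x - c) / s \<and> (x - c) / s < of_int n + 1"
      by (subst eq_commute) (rule floor_eq_iff)
    also have "\<dots> \<longleftrightarrow> of_int n * s \<le> x - c \<and> x - c < (of_int n + 1) * s"
      using s by (simp add: pos_le_divide_eq pos_divide_less_eq)
    finally show ?thesis by (auto simp: algebra_simps)
  qed
  have hs: "h x = (\<Sum>n\<in>J. indicator (?P n) x *\<^sub>R h x)" for x
  proof (cases "h x = 0")
    case False
    have "(\<Sum>n\<in>J. indicator (?P n) x *\<^sub>R h x) = (\<Sum>n\<in>J. if n = \<lfloor>(x - c) / s\<rfloor> then h x else 0)"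
      by (intro sum.cong refl) (auto simp: indicator_def P simp del: atLeastLessThan_iff)
    then show ?thesis using J(1) J(2)[OF False] by simp
  qed simp
  have "(\<integral>x. h x \<partial>lebesgue) = (\<integral>x. (\<Sum>n\<in>J. indicator (?P n) x *\<^sub>R h x) \<partial>lebesgue)"
    by (rule Bochner_Integration.integral_cong[OF refl hs])
  also have "\<dots> = (\<Sum>n\<in>J. \<integral>x. indicator (?P n) x *\<^sub>R h x \<partial>lebesgue)"
    using h by (intro Bochner_Integration.integral_sum integrable_mult_indicator) auto
  also have "\<dots> = (\<Sum>n\<in>J. \<integral>y. h (y + of_int n * s) \<partial>lebesgue_on {c..c + s})"
  proof (rule sum.cong[OF refl])
    fix n
    have "(\<integral>x. indicator (?P n) x *\<^sub>R h x \<partial>lebesgue)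
        = \<bar>1\<bar> *\<^sub>R (\<integral>y. indicator (?P n) (of_int n * s + 1 * y) *\<^sub>R h (of_int n * s + 1 * y) \<partial>lebesgue)"
      by (rule lebesgue_integral_real_affine) simp
    also have "\<dots> = (\<integral>y. indicator {c..<c + s} y *\<^sub>R h (y + of_int n * s) \<partial>lebesgue)"
      unfolding abs_one scaleR_one
      by (intro Bochner_Integration.integral_cong refl) (simp add: indicator_def algebra_simps)
    also have "\<dots> = (\<integral>y. h (y + of_int n * s) \<partial>lebesgue_on {c..c + s})"
      using integral_lebesgue_on_half_open[OF integrable_translate[OF h]] by simp
    finally show "(\<integral>x. indicator (?P n) x *\<^sub>R h x \<partial>lebesgue) = (\<integral>y. h (y + of_int n * s) \<partial>lebesgue_on {c..c + s})" .
  qed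
  also have "\<dots> = (\<integral>y. (\<Sum>n\<in>J. h (y + of_int n * s)) \<partial>lebesgue_on {c..c + s})"
    using h by (intro Bochner_Integration.integral_sum[symmetric] lebesgue_on_integrable integrable_translate)
  finally show ?thesis .
qed

text \<open>One index set serving every \<open>y\<close> of a period. The extra \<open>- 1\<close>
  at the lower end accounts for the right endpoint \<open>y = c + s\<close>, which already belongs
  to the next cell.\<close>

definition window_indices :: "real \<Rightarrow> real \<Rightarrow> real \<Rightarrow> int set" where
  "window_indices s c p = {\<lfloor>(p - 1 - c) / s\<rfloor> - 1..\<lfloor>(p + 1 - c) / s\<rfloor>}"

lemma finite_window_indices [simp]: "finite (window_indices s c p)"
  by (simp add: window_indices_def)

lemma floor_in_window_indices:
  assumes "s > 0" "\<bar>x - p\<bar> < 1"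
  shows "\<lfloor>(x - c) / s\<rfloor> \<in> window_indices s c p"
proof -
  have "(p - 1 - c) / s \<le> (x - c) / s" "(x - c) / s \<le> (p + 1 - c) / s"
    using assms by (auto intro!: divide_right_mono)
  then have "\<lfloor>(p - 1 - c) / s\<rfloor> \<le> \<lfloor>(x - c) / s\<rfloor>" "\<lfloor>(x - c) / s\<rfloor> \<le> \<lfloor>(p + 1 - c) / s\<rfloor>"
    by (auto intro: floor_mono)
  then show ?thesis by (simp add: window_indices_def)
qed

lemma hat_support_window:
  assumes s: "s > 0" and y: "y \<in> {c..c + s}" and n: "\<bar>y + of_int n * s - p\<bar> < 1"
  shows "n \<in> window_indices s c p"
proof -
  have "\<lfloor>(y + of_int n * s - c) / s\<rfloor> = n + \<lfloor>(y - c) / s\<rfloor>"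
  proof -
    have "(y + of_int n * s - c) / s = (y - c) / s + of_int n" using s by (simp add: field_simps)
    then show ?thesis by simp
  qed
  moreover have "0 \<le> (y - c) / s" "(y - c) / s \<le> 1" using s y by auto
  then have "\<lfloor>(y - c) / s\<rfloor> \<in> {0..1}" by (simp add: floor_le_iff)
  moreover have "\<lfloor>(y + of_int n * s - c) / s\<rfloor> \<in> {\<lfloor>(p - 1 - c) / s\<rfloor>..\<lfloor>(p + 1 - c) / s\<rfloor>}"
    using s n by (auto intro!: floor_mono divide_right_mono)
  ultimately show "n \<in> window_indices s c p"
    unfolding window_indices_def atLeastAtMost_iff by linarith
qed

lemma hat_sum_window:
  assumes "s > 0" "y \<in> {c..c + s}"
  shows "hat_sum s f y p = (\<Sum>n\<in>window_indices s c p. B2 (y + of_int n * s - p) *\<^sub>R f (y + of_int n * s))"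
  using hat_sum_eq[OF assms(1) finite_window_indices] hat_support_window[OF assms] by blast

text \<open>The bound is independent of the offset \<open>t\<close>. It is applied to the spacing
  \<open>s\<close>, counting terms of one sum, and to the spacing \<open>a\<close>, counting hats
  over one point.\<close>

lemma card_hat_support_bounded:
  fixes s :: real
  assumes "s > 0"
  shows "\<exists>m. \<forall>t. card {n::int. \<bar>t + of_int n * s\<bar> < 1} \<le> m"
proof (intro exI allI)
  fix t :: real
  have "{n::int. \<bar>t + of_int n * s\<bar> < 1} \<subseteq> {\<lfloor>(-1 - t) / s\<rfloor>..\<lfloor>(1 - t) / s\<rfloor>}"
  proof
    fix n :: int
    assume "n \<in> {n. \<bar>t + of_int n * s\<bar> < 1}"
    then have "(-1 - t) / s \<le> of_int n" "of_int n \<le> (1 - t) / s"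
      using assms by (auto simp: pos_divide_le_eq pos_le_divide_eq)
    then show "n \<in> {\<lfloor>(-1 - t) / s\<rfloor>..\<lfloor>(1 - t) / s\<rfloor>}" by (simp add: floor_le_iff le_floor_iff)
  qed
  then have "card {n::int. \<bar>t + of_int n * s\<bar> < 1} \<le> card {\<lfloor>(-1 - t) / s\<rfloor>..\<lfloor>(1 - t) / s\<rfloor>}"
    by (intro card_mono) auto
  also have "\<dots> \<le> nat (\<lceil>2 / s\<rceil> + 2)"
  proof -
    have "(1 - t) / s = (-1 - t) / s + 2 / s" by (simp add: diff_divide_distrib)
    then have "\<lfloor>(1 - t) / s\<rfloor> \<le> \<lfloor>(-1 - t) / s\<rfloor> + 1 + \<lceil>2 / s\<rceil>" by linarith
    then show ?thesis by simp
  qed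
  finally show "card {n::int. \<bar>t + of_int n * s\<bar> < 1} \<le> nat (\<lceil>2 / s\<rceil> + 2)" .
qed

lemma L2_D:
  assumes "f \<in> L2"
  shows "f \<in> borel_measurable lebesgue" "integrable lebesgue (\<lambda>x. (cmod (f x))\<^sup>2)"
  using assms by (auto simp: L2_def)

lemma continuous_imp_borel_measurable_lebesgue:
  fixes h :: "real \<Rightarrow> 'a::euclidean_space"
  shows "continuous_on UNIV h \<Longrightarrow> h \<in> borel_measurable lebesgue"
  using continuous_imp_measurable_on_sets_lebesgue[of UNIV h] by (simp add: lebesgue_on_UNIV_eq)

lemma borel_measurable_B2: "(\<lambda>x. B2 (x - p)) \<in> borel_measurable lebesgue"
  by (intro continuous_imp_borel_measurable_lebesgue continuous_intros)

lemma L2_mult_bounded: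
  assumes f: "f \<in> L2" and g: "g \<in> borel_measurable lebesgue" "\<And>x. \<bar>g x\<bar> \<le> (1::real)"
  shows "(\<lambda>x. g x *\<^sub>R f x) \<in> L2"
proof -
  have "integrable lebesgue (\<lambda>x. (cmod (g x *\<^sub>R f x))\<^sup>2)"
  proof (rule Bochner_Integration.integrable_bound[OF L2_D(2)[OF f]])
    show "AE x in lebesgue. norm ((cmod (g x *\<^sub>R f x))\<^sup>2) \<le> norm ((cmod (f x))\<^sup>2)"
    proof (intro AE_I2)
      fix x
      have "cmod (g x *\<^sub>R f x) \<le> 1 * cmod (f x)"
        unfolding norm_scaleR using g(2) by (intro mult_right_mono) auto
      then have "(cmod (g x *\<^sub>R f x))\<^sup>2 \<le> (cmod (f x))\<^sup>2" by (intro power_mono) auto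
      then show "norm ((cmod (g x *\<^sub>R f x))\<^sup>2) \<le> norm ((cmod (f x))\<^sup>2)"
        by (simp only: real_norm_def abs_power2)
    qed
  qed (use g(1) L2_D(1)[OF f] in measurable)
  then show ?thesis using g(1) L2_D(1)[OF f] by (simp add: L2_def)
qed

lemma hat_sum_L2:
  assumes s: "s > 0" and f: "f \<in> L2"
  shows "(\<lambda>y. hat_sum s f y p) \<in> borel_measurable (lebesgue_on {c..c + s})"
    and "integrable (lebesgue_on {c..c + s}) (\<lambda>y. (cmod (hat_sum s f y p))\<^sup>2)"
proof -
  let ?M = "lebesgue_on {c..c + s}"
  define u where "u n y = B2 (y + of_int n * s - p) *\<^sub>R f (y + of_int n * s)" for n :: int and y
  have u: "u n \<in> borel_measurable ?M \<and> integrable ?M (\<lambda>y. (cmod (u n y))\<^sup>2)" for n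
  proof -
    have "(\<lambda>x. B2 (x - p) *\<^sub>R f x) \<in> L2"
      by (rule L2_mult_bounded[OF f borel_measurable_B2]) (simp add: B2_eq)
    from L2_D[OF this] show ?thesis unfolding u_def
      using measurable_translate[of "\<lambda>x. B2 (x - p) *\<^sub>R f x" "of_int n * s"]
        integrable_translate[of "\<lambda>x. (cmod (B2 (x - p) *\<^sub>R f x))\<^sup>2" "of_int n * s"]
      by (auto intro: lebesgue_on_measurable lebesgue_on_integrable)
  qed
  have "(\<lambda>y. \<Sum>n\<in>J. u n y) \<in> borel_measurable ?M \<and> integrable ?M (\<lambda>y. (cmod (\<Sum>n\<in>J. u n y))\<^sup>2)"
    if "finite J" for J
    using that
  proof (induction J rule: finite_induct)
    case (insert n J)
    then show ?case
      using u[of n] integrable_norm_add_sq[of "u n" ?M "\<lambda>y. \<Sum>n\<in>J. u n y"]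
      by (simp add: borel_measurable_add)
  qed simp
  then have v: "(\<lambda>y. \<Sum>n\<in>window_indices s c p. u n y) \<in> borel_measurable ?M"
    "integrable ?M (\<lambda>y. (cmod (\<Sum>n\<in>window_indices s c p. u n y))\<^sup>2)" by auto
  have e: "hat_sum s f y p = (\<Sum>n\<in>window_indices s c p. u n y)" if "y \<in> space ?M" for y
    using hat_sum_window[OF s, of y c f p] that by (simp add: u_def)
  show "(\<lambda>y. hat_sum s f y p) \<in> borel_measurable ?M"
    using v(1) by (subst measurable_cong[OF e])
  show "integrable ?M (\<lambda>y. (cmod (hat_sum s f y p))\<^sup>2)"
    by (rule iffD2[OF Bochner_Integration.integrable_cong[OF refl] v(2)]) (simp only: e)
qed

abbreviation hat_gabor :: "real \<Rightarrow> real \<Rightarrow> int \<times> int \<Rightarrow> real \<Rightarrow> complex" where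
  "hat_gabor a b \<equiv> gabor_system (\<lambda>x. complex_of_real (B2 x)) a b"

lemma hat_gabor_eq: "hat_gabor a b (l, k) x = fourier_exp b l x * complex_of_real (B2 (x - of_int k * a))"
  by (simp add: gabor_system_def modulation_def translation_def fourier_exp_def)

lemma hat_gabor_in_L2: "hat_gabor a b i \<in> L2"
proof -
  obtain l k where i: "i = (l, k)" by force
  let ?p = "of_int k * a"
  have c: "continuous_on S (\<lambda>x. fourier_exp b l x * complex_of_real (B2 (x - ?p)))" for S
    by (intro continuous_intros)
  have e: "(cmod (fourier_exp b l x * complex_of_real (B2 (x - ?p))))\<^sup>2 = indicator {?p - 1..?p + 1} x *\<^sub>R (B2 (x - ?p))\<^sup>2" for x
    by (auto simp: norm_mult B2_eq indicator_def)
  have "integrable lebesgue (\<lambda>x. (cmod (fourier_exp b l x * complex_of_real (B2 (x - ?p))))\<^sup>2)"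
    unfolding e
    by (subst integrable_restrict_space[symmetric])
      (auto intro!: continuous_imp_integrable_real continuous_intros)
  moreover have "(\<lambda>x. fourier_exp b l x * complex_of_real (B2 (x - ?p))) \<in> borel_measurable lebesgue"
    by (intro continuous_imp_borel_measurable_lebesgue c)
  ultimately show ?thesis unfolding L2_def i hat_gabor_eq[abs_def] by simp
qed

text \<open>The exponential of frequency \<open>l * b\<close> has period \<open>1 / b\<close>, so
  after folding the integral onto one period it is a common factor and the remaining sum is
  \<open>hat_sum\<close>.\<close>

lemma L2_inner_hat_gabor:
  assumes b: "b > 0" and f: "f \<in> L2"
  shows "L2_inner f (hat_gabor a b (l, k)) = fourier_coeff b c (\<lambda>y. hat_sum (1 / b) f y (of_int k * a)) l"
proof -
  let ?p = "of_int k * a" and ?s = "1 / b"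
  have s: "?s > 0" using b by simp
  define h where "h x = f x * cnj (fourier_exp b l x * complex_of_real (B2 (x - ?p)))" for x
  have fm: "f \<in> borel_measurable lebesgue" using L2_D[OF f] by auto
  have gm: "hat_gabor a b (l, k) \<in> borel_measurable lebesgue" using L2_D(1)[OF hat_gabor_in_L2] .
  have h: "integrable lebesgue h"
  proof (rule Bochner_Integration.integrable_bound)
    show "integrable lebesgue (\<lambda>x. (cmod (f x))\<^sup>2 + (cmod (hat_gabor a b (l, k) x))\<^sup>2)"
      using L2_D(2)[OF f] L2_D(2)[OF hat_gabor_in_L2[of a b "(l, k)"]] by (rule Bochner_Integration.integrable_add)
    show "AE x in lebesgue. norm (h x) \<le> norm ((cmod (f x))\<^sup>2 + (cmod (hat_gabor a b (l, k) x))\<^sup>2)"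
    proof (intro AE_I2)
      fix x
      have "norm (h x) = cmod (f x) * cmod (hat_gabor a b (l, k) x)" by (simp add: h_def hat_gabor_eq norm_mult)
      also have "\<dots> \<le> 2 * (cmod (f x) * cmod (hat_gabor a b (l, k) x))" by simp
      also have "\<dots> \<le> (cmod (f x))\<^sup>2 + (cmod (hat_gabor a b (l, k) x))\<^sup>2"
        using sum_squares_bound[of "cmod (f x)" "cmod (hat_gabor a b (l, k) x)"] by (simp add: mult.assoc)
      finally show "norm (h x) \<le> norm ((cmod (f x))\<^sup>2 + (cmod (hat_gabor a b (l, k) x))\<^sup>2)" by simp
    qed
    have "(\<lambda>x. fourier_exp b (- l) x * complex_of_real (B2 (x - ?p))) \<in> borel_measurable lebesgue"
      by (intro continuous_imp_borel_measurable_lebesgue continuous_intros)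
    then show "h \<in> borel_measurable lebesgue"
      using fm unfolding h_def complex_cnj_mult cnj_fourier_exp by simp
  qed
  have "L2_inner f (hat_gabor a b (l, k)) = (\<integral>x. h x \<partial>lebesgue)"
    by (simp add: L2_inner_def h_def hat_gabor_eq)
  also have "\<dots> = (\<integral>y. (\<Sum>n\<in>window_indices ?s c ?p. h (y + of_int n * ?s)) \<partial>lebesgue_on {c..c + ?s})"
  proof (rule integral_periodize[OF s h finite_window_indices])
    fix x assume "h x \<noteq> 0"
    then have "\<bar>x - ?p\<bar> < 1" by (auto simp: h_def B2_eq max_def split: if_splits)
    then show "\<lfloor>(x - c) / ?s\<rfloor> \<in> window_indices ?s c ?p" by (rule floor_in_window_indices[OF s])
  qed
  also have "\<dots> = fourier_coeff b c (\<lambda>y. hat_sum ?s f y ?p) l"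
    unfolding fourier_coeff_def
  proof (rule Bochner_Integration.integral_cong[OF refl])
    fix y assume "y \<in> space (lebesgue_on {c..c + ?s})"
    then have y: "y \<in> {c..c + ?s}" by simp
    have "fourier_exp b l (y + of_int n * ?s) = fourier_exp b l y" for n
      using fourier_exp_periodic[OF b, of l y n] by simp
    then show "(\<Sum>n\<in>window_indices ?s c ?p. h (y + of_int n * ?s)) = hat_sum ?s f y ?p * cnj (fourier_exp b l y)"
      unfolding hat_sum_window[OF s y] sum_distrib_right
      by (intro sum.cong refl) (simp only: h_def complex_cnj_mult complex_cnj_complex_of_real scaleR_conv_of_real mult_ac)
  qed
  finally show ?thesis .
qed

lemma has_sum_hat_gabor_coeffs:
  assumes b: "b > 0" and f: "f \<in> L2"
  shows "((\<lambda>l. (cmod (L2_inner f (hat_gabor a b (l, k))))\<^sup>2) has_sum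
    (\<integral>y. (cmod (hat_sum (1 / b) f y (of_int k * a)))\<^sup>2 \<partial>lebesgue_on {c..c + 1 / b}) / b) UNIV"
  unfolding L2_inner_hat_gabor[OF b f, of a _ k c]
  using hat_sum_L2[of "1 / b" f] b f by (intro parseval) auto

subsection \<open>Frame bounds\<close>

lemma norm_sum_sq_le:
  fixes u :: "'i \<Rightarrow> 'a::real_normed_vector"
  assumes "card I \<le> m"
  shows "(norm (\<Sum>i\<in>I. u i))\<^sup>2 \<le> real m * (\<Sum>i\<in>I. (norm (u i))\<^sup>2)"
proof -
  have "(norm (\<Sum>i\<in>I. u i))\<^sup>2 \<le> (\<Sum>i\<in>I. norm (u i))\<^sup>2" by (intro power_mono norm_sum) auto
  also have "\<dots> \<le> (\<Sum>i\<in>I. (norm (u i))\<^sup>2) * real (card I)"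
    by (rule sum_squared_le_sum_of_squares)
  also have "\<dots> \<le> (\<Sum>i\<in>I. (norm (u i))\<^sup>2) * real m"
    using assms by (intro mult_left_mono sum_nonneg) auto
  finally show ?thesis by (simp add: mult.commute)
qed

text \<open>Cauchy-Schwarz over at most \<open>m\<close> terms, followed by unfolding the period
  integral back to the line.\<close>

lemma integral_hat_sum_sq_le:
  assumes s: "s > 0" and f: "f \<in> L2" and m: "\<And>t. card {n::int. \<bar>t + of_int n * s\<bar> < 1} \<le> m"
  shows "(\<integral>y. (cmod (hat_sum s f y p))\<^sup>2 \<partial>lebesgue_on {c..c + s})
    \<le> real m * (\<integral>x. indicator {x. \<bar>x - p\<bar> < 1} x * (cmod (f x))\<^sup>2 \<partial>lebesgue)"
proof -
  let ?I = "lebesgue_on {c..c + s}"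
  define h where "h x = indicator {x. \<bar>x - p\<bar> < 1} x * (cmod (f x))\<^sup>2" for x
  have "{x. \<bar>x - p\<bar> < 1} = ball p 1" by (auto simp: dist_real_def)
  then have h: "integrable lebesgue h"
    using integrable_mult_indicator[OF _ L2_D(2)[OF f], of "{x. \<bar>x - p\<bar> < 1}"] by (simp add: h_def[abs_def])
  have W: "integrable ?I (\<lambda>y. \<Sum>n\<in>window_indices s c p. h (y + of_int n * s))"
    using h by (intro Bochner_Integration.integrable_sum lebesgue_on_integrable integrable_translate)
  have "(\<integral>y. (cmod (hat_sum s f y p))\<^sup>2 \<partial>?I) \<le> (\<integral>y. real m * (\<Sum>n\<in>window_indices s c p. h (y + of_int n * s)) \<partial>?I)"
  proof (rule integral_mono)
    show "integrable ?I (\<lambda>y. (cmod (hat_sum s f y p))\<^sup>2)" by (rule hat_sum_L2[OF s f])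
    show "integrable ?I (\<lambda>y. real m * (\<Sum>n\<in>window_indices s c p. h (y + of_int n * s)))" using W by simp
    fix y assume "y \<in> space ?I"
    then have y: "y \<in> {c..c + s}" by simp
    let ?N = "{n::int. \<bar>y + of_int n * s - p\<bar> < 1}"
    have card: "card ?N \<le> m" using m[of "y - p"] by (simp add: algebra_simps)
    have "(cmod (hat_sum s f y p))\<^sup>2 \<le> real m * (\<Sum>n\<in>?N. (cmod (B2 (y + of_int n * s - p) *\<^sub>R f (y + of_int n * s)))\<^sup>2)"
      unfolding hat_sum_def by (rule norm_sum_sq_le[OF card])
    also have "\<dots> \<le> real m * (\<Sum>n\<in>?N. h (y + of_int n * s))"
    proof (intro mult_left_mono sum_mono)
      fix n assume n: "n \<in> ?N"
      have "cmod (B2 (y + of_int n * s - p) *\<^sub>R f (y + of_int n * s)) \<le> 1 * cmod (f (y + of_int n * s))"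
        unfolding norm_scaleR by (intro mult_right_mono) (auto simp: B2_eq)
      then have "(cmod (B2 (y + of_int n * s - p) *\<^sub>R f (y + of_int n * s)))\<^sup>2 \<le> (cmod (f (y + of_int n * s)))\<^sup>2"
        by (intro power_mono) auto
      then show "(cmod (B2 (y + of_int n * s - p) *\<^sub>R f (y + of_int n * s)))\<^sup>2 \<le> h (y + of_int n * s)"
        using n by (simp add: h_def)
    qed simp
    also have "(\<Sum>n\<in>?N. h (y + of_int n * s)) \<le> (\<Sum>n\<in>?N \<union> window_indices s c p. h (y + of_int n * s))"
      using finite_hat_support[OF s, of y p] by (intro sum_mono2) (auto simp: h_def)
    also have "\<dots> = (\<Sum>n\<in>window_indices s c p. h (y + of_int n * s))"
    proof -
      have "?N \<subseteq> window_indices s c p" using hat_support_window[OF s y] by auto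
      then show ?thesis by (simp add: Un_absorb1)
    qed
    finally show "(cmod (hat_sum s f y p))\<^sup>2 \<le> real m * (\<Sum>n\<in>window_indices s c p. h (y + of_int n * s))"
      by (simp add: mult_left_mono)
  qed
  also have "\<dots> = real m * (\<integral>y. (\<Sum>n\<in>window_indices s c p. h (y + of_int n * s)) \<partial>?I)" by simp
  also have "(\<integral>y. (\<Sum>n\<in>window_indices s c p. h (y + of_int n * s)) \<partial>?I) = (\<integral>x. h x \<partial>lebesgue)"
    by (rule integral_periodize[OF s h finite_window_indices, symmetric])
      (auto simp: h_def indicator_def intro: floor_in_window_indices[OF s] split: if_splits)
  finally show ?thesis by (simp add: h_def)
qed

definition gabor_energy :: "real \<Rightarrow> real \<Rightarrow> (real \<Rightarrow> complex) \<Rightarrow> int \<times> int \<Rightarrow> real" where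
  "gabor_energy a b f i = (cmod (L2_inner f (hat_gabor a b i)))\<^sup>2"

lemma gabor_energy_nonneg [simp]: "0 \<le> gabor_energy a b f i"
  by (simp add: gabor_energy_def)

lemma L2_norm_sq: "(L2_norm f)\<^sup>2 = (\<integral>x. (cmod (f x))\<^sup>2 \<partial>lebesgue)"
  by (simp add: L2_norm_def)

lemma gabor_upper_bound:
  assumes a: "a > 0" and b: "b > 0"
  shows "\<exists>B>0. \<forall>f\<in>L2. gabor_energy a b f summable_on UNIV \<and> infsum (gabor_energy a b f) UNIV \<le> B * (L2_norm f)\<^sup>2"
proof -
  have s: "1 / b > 0" using b by simp
  obtain m where m: "\<And>t. card {n::int. \<bar>t + of_int n * (1 / b)\<bar> < 1} \<le> m"
    using card_hat_support_bounded[OF s] by blast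
  obtain m' where m': "\<And>t. card {k::int. \<bar>t + of_int k * a\<bar> < 1} \<le> m'"
    using card_hat_support_bounded[OF a] by blast
  \<comment> \<open>The summand \<open>1\<close> guarantees a strictly positive frame
    constant.\<close>
  define B where "B = real m * real m' / b + 1"
  have "sum (gabor_energy a b f) F \<le> B * (L2_norm f)\<^sup>2" if f: "f \<in> L2" and F: "finite F" for f F
  proof -
    let ?K = "snd ` F" and ?L = "fst ` F"
    let ?u = "\<lambda>k x. indicator {x. \<bar>x - of_int k * a\<bar> < 1} x * (cmod (f x))\<^sup>2"
    have fin: "finite ?K" "finite ?L" using F by auto
    have u: "integrable lebesgue (?u k)" for k :: int
    proof -
      have "{x. \<bar>x - of_int k * a\<bar> < 1} = ball (of_int k * a) 1" by (auto simp: dist_real_def)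
      then show ?thesis
        using integrable_mult_indicator[OF _ L2_D(2)[OF f], of "{x. \<bar>x - of_int k * a\<bar> < 1}"] by simp
    qed
    \<comment> \<open>Enlarging \<open>F\<close> to a product separates the frequencies, which
      Parseval absorbs, from the translations, which overlap at most \<open>m'\<close> times at each
      point.\<close>
    have "sum (gabor_energy a b f) F \<le> sum (gabor_energy a b f) (?L \<times> ?K)"
      using fin by (intro sum_mono2 subset_fst_snd) auto
    also have "\<dots> = (\<Sum>k\<in>?K. \<Sum>l\<in>?L. gabor_energy a b f (l, k))"
      by (subst sum.swap) (simp add: sum.cartesian_product)
    also have "\<dots> \<le> (\<Sum>k\<in>?K. (\<integral>y. (cmod (hat_sum (1 / b) f y (of_int k * a)))\<^sup>2 \<partial>lebesgue_on {0..0 + 1 / b}) / b)"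
    proof (rule sum_mono)
      fix k
      show "(\<Sum>l\<in>?L. gabor_energy a b f (l, k)) \<le> (\<integral>y. (cmod (hat_sum (1 / b) f y (of_int k * a)))\<^sup>2 \<partial>lebesgue_on {0..0 + 1 / b}) / b"
        using has_sum_hat_gabor_coeffs[OF b f, of a k 0] fin(2)
        unfolding gabor_energy_def by (intro finite_sum_le_has_sum) auto
    qed
    also have "\<dots> \<le> (\<Sum>k\<in>?K. (real m * (\<integral>x. ?u k x \<partial>lebesgue)) / b)"
      using b by (intro sum_mono divide_right_mono integral_hat_sum_sq_le[OF s f m]) auto
    also have "\<dots> = real m / b * (\<integral>x. (\<Sum>k\<in>?K. ?u k x) \<partial>lebesgue)"
      using u by (simp add: sum_distrib_left sum_divide_distrib)
    also have "\<dots> \<le> real m / b * (\<integral>x. real m' * (cmod (f x))\<^sup>2 \<partial>lebesgue)"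
    proof (intro mult_left_mono integral_mono)
      show "integrable lebesgue (\<lambda>x. \<Sum>k\<in>?K. ?u k x)" using u by (rule Bochner_Integration.integrable_sum)
      show "integrable lebesgue (\<lambda>x. real m' * (cmod (f x))\<^sup>2)" using L2_D(2)[OF f] by simp
      fix x
      let ?N = "{k::int. \<bar>- x + of_int k * a\<bar> < 1}"
      have finN: "finite ?N" using finite_hat_support[OF a, of "- x" 0] by simp
      have "(\<Sum>k\<in>?K. ?u k x) = (\<Sum>k\<in>?K \<inter> ?N. (cmod (f x))\<^sup>2)"
        using fin(1) by (intro sum.mono_neutral_cong_right) (auto simp: indicator_def)
      also have "\<dots> = real (card (?K \<inter> ?N)) * (cmod (f x))\<^sup>2" by simp
      also have "\<dots> \<le> real m' * (cmod (f x))\<^sup>2"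
        using card_mono[OF finN, of "?K \<inter> ?N"] m'[of "- x"] by (intro mult_right_mono) auto
      finally show "(\<Sum>k\<in>?K. ?u k x) \<le> real m' * (cmod (f x))\<^sup>2" .
    qed (use b in auto)
    also have "\<dots> = (real m * real m' / b) * (L2_norm f)\<^sup>2" by (simp add: L2_norm_sq)
    also have "\<dots> \<le> B * (L2_norm f)\<^sup>2" unfolding B_def by (intro mult_right_mono) auto
    finally show ?thesis .
  qed
  note fin = this
  have "gabor_energy a b f summable_on UNIV \<and> infsum (gabor_energy a b f) UNIV \<le> B * (L2_norm f)\<^sup>2" if f: "f \<in> L2" for f
  proof
    show S: "gabor_energy a b f summable_on UNIV"
    proof (rule nonneg_bdd_above_summable_on)
      show "bdd_above (sum (gabor_energy a b f) ` {F. F \<subseteq> UNIV \<and> finite F})"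
        using fin[OF f] by (intro bdd_aboveI2) auto
    qed simp
    show "infsum (gabor_energy a b f) UNIV \<le> B * (L2_norm f)\<^sup>2"
      using fin[OF f] by (intro infsum_le_finite_sums S) auto
  qed
  moreover have "B > 0" using b unfolding B_def by (intro add_nonneg_pos divide_nonneg_pos) auto
  ultimately show ?thesis by blast
qed

text \<open>Real and imaginary parts are recovered separately, giving the factor
  \<open>2 * C\<close>; squaring costs the number of sums by Cauchy-Schwarz.\<close>

lemma recoverable_complex:
  assumes "recoverable s a T"
  shows "\<exists>C\<ge>0. \<exists>N\<ge>0. \<forall>(f::real \<Rightarrow> complex) y (k::int). \<bar>y - of_int k * a\<bar> \<le> T \<longrightarrow>
     (cmod (f y))\<^sup>2 \<le> C * (\<Sum>j\<in>{-N..N}. (cmod (hat_sum s f y (of_int (k + j) * a)))\<^sup>2)"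
proof -
  obtain C N where C: "C \<ge> 0" "N \<ge> (0::int)"
    and R: "\<And>(f::real \<Rightarrow> real) y (k::int). \<bar>y - of_int k * a\<bar> \<le> T \<Longrightarrow>
     \<bar>f y\<bar> \<le> C * (\<Sum>j\<in>{-N..N}. \<bar>hat_sum s f y (of_int (k + j) * a)\<bar>)"
    using assms unfolding recoverable_def by blast
  define C' where "C' = (2 * C)\<^sup>2 * real (card {-N..N})"
  have main: "(cmod (f y))\<^sup>2 \<le> C' * (\<Sum>j\<in>{-N..N}. (cmod (hat_sum s f y (of_int (k + j) * a)))\<^sup>2)"
    if y: "\<bar>y - of_int k * a\<bar> \<le> T" for f :: "real \<Rightarrow> complex" and y and k :: int
  proof -
    let ?h = "\<lambda>j. hat_sum s f y (of_int (k + j) * a)"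
    have "\<bar>g (f y)\<bar> \<le> C * (\<Sum>j\<in>{-N..N}. cmod (?h j))"
      if g: "bounded_linear g" "\<And>z. \<bar>g z\<bar> \<le> cmod z" for g :: "complex \<Rightarrow> real"
    proof -
      have "\<bar>g (f y)\<bar> \<le> C * (\<Sum>j\<in>{-N..N}. \<bar>hat_sum s (\<lambda>x. g (f x)) y (of_int (k + j) * a)\<bar>)"
        by (rule R[OF y, of "\<lambda>x. g (f x)"])
      also have "\<dots> \<le> C * (\<Sum>j\<in>{-N..N}. cmod (?h j))"
        unfolding hat_sum_bounded_linear[OF g(1), symmetric] using C(1) g(2) by (intro mult_left_mono sum_mono)
      finally show ?thesis .
    qed
    from this[OF bounded_linear_Re abs_Re_le_cmod] this[OF bounded_linear_Im abs_Im_le_cmod]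
    have "cmod (f y) \<le> 2 * C * (\<Sum>j\<in>{-N..N}. cmod (?h j))"
      using cmod_le[of "f y"] by linarith
    then have "(cmod (f y))\<^sup>2 \<le> (2 * C * (\<Sum>j\<in>{-N..N}. cmod (?h j)))\<^sup>2" by (intro power_mono) auto
    also have "\<dots> = (2 * C)\<^sup>2 * (\<Sum>j\<in>{-N..N}. cmod (?h j))\<^sup>2" by (simp add: power_mult_distrib)
    also have "\<dots> \<le> (2 * C)\<^sup>2 * ((\<Sum>j\<in>{-N..N}. (cmod (?h j))\<^sup>2) * real (card {-N..N}))"
      by (intro mult_left_mono sum_squared_le_sum_of_squares) auto
    finally show ?thesis unfolding C'_def by (simp only: mult_ac)
  qed
  have "C' \<ge> 0" by (simp add: C'_def)
  then show ?thesis
    by (intro exI[of _ C'] exI[of _ N] conjI C(2) allI impI main)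
qed

lemma has_sum_finite_sum:
  fixes u :: "'k \<Rightarrow> 'i \<Rightarrow> real"
  assumes "finite K" "\<And>k. k \<in> K \<Longrightarrow> (u k has_sum S k) A"
  shows "((\<lambda>i. \<Sum>k\<in>K. u k i) has_sum (\<Sum>k\<in>K. S k)) A"
  using assms by (induction K rule: finite_induct) (auto intro: has_sum_add)

text \<open>Parseval holds over any period, so the base point \<open>c k\<close> may vary with the
  fibre. Summing finitely many fibres before the frequencies reduces the double sum to finite
  subsums of the total energy.\<close>

lemma sum_fiber_energy_le:
  assumes b: "b > 0" and f: "f \<in> L2" and S: "gabor_energy a b f summable_on UNIV" and K: "finite K"
  shows "(\<Sum>k\<in>K. (\<integral>y. (cmod (hat_sum (1 / b) f y (of_int k * a)))\<^sup>2 \<partial>lebesgue_on {c k..c k + 1 / b}) / b)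
    \<le> infsum (gabor_energy a b f) UNIV"
proof (rule has_sum_le_finite_sums)
  show "((\<lambda>l. \<Sum>k\<in>K. gabor_energy a b f (l, k)) has_sum
    (\<Sum>k\<in>K. (\<integral>y. (cmod (hat_sum (1 / b) f y (of_int k * a)))\<^sup>2 \<partial>lebesgue_on {c k..c k + 1 / b}) / b)) UNIV"
    unfolding gabor_energy_def using has_sum_hat_gabor_coeffs[OF b f] K by (intro has_sum_finite_sum) auto
  fix L :: "int set" assume L: "finite L" "L \<subseteq> UNIV"
  have "(\<Sum>l\<in>L. \<Sum>k\<in>K. gabor_energy a b f (l, k)) = sum (gabor_energy a b f) (L \<times> K)"
    by (simp add: sum.cartesian_product)
  also have "\<dots> \<le> infsum (gabor_energy a b f) UNIV"
    using L K by (intro finite_sum_le_infsum S) auto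
  finally show "(\<Sum>l\<in>L. \<Sum>k\<in>K. gabor_energy a b f (l, k)) \<le> infsum (gabor_energy a b f) UNIV" .
qed

lemma gabor_lower_bound:
  assumes a: "a > 0" and b: "b > 0" and ab: "a \<le> 1 / b" and R: "recoverable (1 / b) a (a / 2)"
  shows "\<exists>D>0. \<forall>f\<in>L2. gabor_energy a b f summable_on UNIV \<longrightarrow>
    (L2_norm f)\<^sup>2 \<le> D * infsum (gabor_energy a b f) UNIV"
proof -
  have s: "1 / b > 0" using b by simp
  obtain C N where C: "C \<ge> 0" "N \<ge> (0::int)"
    and rec: "\<And>(f::real \<Rightarrow> complex) y (k::int). \<bar>y - of_int k * a\<bar> \<le> a / 2 \<Longrightarrow>
     (cmod (f y))\<^sup>2 \<le> C * (\<Sum>j\<in>{-N..N}. (cmod (hat_sum (1 / b) f y (of_int (k + j) * a)))\<^sup>2)"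
    using recoverable_complex[OF R] by blast
  define D where "D = C * b * real (card {-N..N}) + 1"
  have fin: "(\<integral>x. indicator {- (real n * a)..real n * a} x * (cmod (f x))\<^sup>2 \<partial>lebesgue) \<le> D * infsum (gabor_energy a b f) UNIV"
    if f: "f \<in> L2" and S: "gabor_energy a b f summable_on UNIV" for f n
  proof -
    let ?E = "infsum (gabor_energy a b f) UNIV"
    \<comment> \<open>The intervals \<open>I k\<close> cover the line and consist of the points with
      offset at most \<open>a / 2\<close> from \<open>k * a\<close>; \<open>a \<le> 1 / b\<close>
      lets each of them fit into the single period \<open>J k\<close>.\<close>
    define I where "I k = {of_int k * a - a / 2..of_int k * a + a / 2}" for k :: int
    define J where "J k = {of_int k * a - a / 2..of_int k * a - a / 2 + 1 / b}" for k :: int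
    let ?K = "{- int n..int n}"
    let ?T = "\<lambda>k j. \<integral>y. (cmod (hat_sum (1 / b) f y (of_int (k + j) * a)))\<^sup>2 \<partial>lebesgue_on (J k)"
    have fi: "integrable lebesgue (\<lambda>x. (cmod (f x))\<^sup>2)" by (rule L2_D(2)[OF f])
    have iI: "integrable lebesgue (\<lambda>x. indicator (I k) x * (cmod (f x))\<^sup>2)" for k
      using integrable_mult_indicator[OF _ fi, of "I k"] by (simp add: I_def)
    have hi: "integrable (lebesgue_on (J k)) (\<lambda>y. (cmod (hat_sum (1 / b) f y p))\<^sup>2)" for k p
      unfolding J_def by (rule hat_sum_L2[OF s f])
    have "(\<integral>x. indicator {- (real n * a)..real n * a} x * (cmod (f x))\<^sup>2 \<partial>lebesgue)
      \<le> (\<integral>x. (\<Sum>k\<in>?K. indicator (I k) x * (cmod (f x))\<^sup>2) \<partial>lebesgue)"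
    proof (rule integral_mono)
      show "integrable lebesgue (\<lambda>x. indicator {- (real n * a)..real n * a} x * (cmod (f x))\<^sup>2)"
        using integrable_mult_indicator[OF _ fi, of "{- (real n * a)..real n * a}"] by simp
      show "integrable lebesgue (\<lambda>x. \<Sum>k\<in>?K. indicator (I k) x * (cmod (f x))\<^sup>2)"
        using iI by (rule Bochner_Integration.integrable_sum)
      fix x
      show "indicator {- (real n * a)..real n * a} x * (cmod (f x))\<^sup>2 \<le> (\<Sum>k\<in>?K. indicator (I k) x * (cmod (f x))\<^sup>2)"
      proof (cases "x \<in> {- (real n * a)..real n * a}")
        case True
        define k where "k = round (x / a)"
        have "\<bar>x / a - of_int k\<bar> \<le> 1/2" using of_int_round_abs_le[of "x / a"] by (simp add: k_def abs_minus_commute)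
        then have "\<bar>x - of_int k * a\<bar> \<le> a / 2" using a by (simp add: abs_le_iff field_simps)
        then have xk: "x \<in> I k" unfolding I_def atLeastAtMost_iff by linarith
        have "- real n \<le> x / a" "x / a \<le> real n" using True a by (auto simp: field_simps)
        then have "round (- real n) \<le> k" "k \<le> round (real n)" unfolding k_def by (simp_all only: round_mono)
        moreover have "round (- real n) = - int n" using round_of_int[of "- int n", where 'a = real] by simp
        ultimately have kK: "k \<in> ?K" by auto
        have "indicator {- (real n * a)..real n * a} x * (cmod (f x))\<^sup>2 = indicator (I k) x * (cmod (f x))\<^sup>2"
          using True xk by simp
        also have "\<dots> \<le> (\<Sum>k\<in>?K. indicator (I k) x * (cmod (f x))\<^sup>2)"
          using kK by (intro member_le_sum) auto
        finally show ?thesis .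
      qed (auto intro: sum_nonneg)
    qed
    also have "\<dots> = (\<Sum>k\<in>?K. \<integral>x. indicator (I k) x * (cmod (f x))\<^sup>2 \<partial>lebesgue)"
      using iI by (rule Bochner_Integration.integral_sum)
    also have "\<dots> \<le> (\<Sum>k\<in>?K. C * (\<Sum>j\<in>{-N..N}. ?T k j))"
    proof (rule sum_mono)
      fix k
      have IJ: "I k \<subseteq> J k" using ab by (auto simp: I_def J_def)
      have "(\<integral>x. indicator (I k) x * (cmod (f x))\<^sup>2 \<partial>lebesgue)
        = (\<integral>x. indicator (J k) x *\<^sub>R (indicator (I k) x * (cmod (f x))\<^sup>2) \<partial>lebesgue)"
        using IJ by (intro Bochner_Integration.integral_cong refl) (auto simp: indicator_def)
      also have "\<dots> = (\<integral>x. indicator (I k) x * (cmod (f x))\<^sup>2 \<partial>lebesgue_on (J k))"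
        by (rule integral_restrict_space[symmetric]) (simp add: J_def)
      also have "\<dots> \<le> (\<integral>y. C * (\<Sum>j\<in>{-N..N}. (cmod (hat_sum (1 / b) f y (of_int (k + j) * a)))\<^sup>2) \<partial>lebesgue_on (J k))"
      proof (rule integral_mono)
        show "integrable (lebesgue_on (J k)) (\<lambda>x. indicator (I k) x * (cmod (f x))\<^sup>2)"
          unfolding J_def by (rule lebesgue_on_integrable[OF iI])
        show "integrable (lebesgue_on (J k)) (\<lambda>y. C * (\<Sum>j\<in>{-N..N}. (cmod (hat_sum (1 / b) f y (of_int (k + j) * a)))\<^sup>2))"
          using hi by (intro integrable_mult_right Bochner_Integration.integrable_sum)
        fix y
        show "indicator (I k) y * (cmod (f y))\<^sup>2 \<le> C * (\<Sum>j\<in>{-N..N}. (cmod (hat_sum (1 / b) f y (of_int (k + j) * a)))\<^sup>2)"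
        proof (cases "y \<in> I k")
          case True
          then have "\<bar>y - of_int k * a\<bar> \<le> a / 2" unfolding I_def atLeastAtMost_iff by linarith
          from rec[OF this] show ?thesis using True by simp
        qed (use C in \<open>auto intro!: mult_nonneg_nonneg sum_nonneg\<close>)
      qed
      also have "\<dots> = C * (\<Sum>j\<in>{-N..N}. ?T k j)" using hi by simp
      finally show "(\<integral>x. indicator (I k) x * (cmod (f x))\<^sup>2 \<partial>lebesgue) \<le> C * (\<Sum>j\<in>{-N..N}. ?T k j)" .
    qed
    also have "\<dots> = C * (\<Sum>j\<in>{-N..N}. \<Sum>k\<in>?K. ?T k j)"
      unfolding sum_distrib_left[symmetric] by (subst sum.swap) (rule refl)
    also have "\<dots> \<le> C * (\<Sum>j\<in>{-N..N}. b * ?E)"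
    proof (intro mult_left_mono sum_mono C(1))
      fix j
      \<comment> \<open>For fixed \<open>j\<close>, renaming \<open>k + j\<close> to
        \<open>k\<close> turns these into integrals of distinct fibres. The period keeps its old
        position, now written with \<open>k - j\<close>, which the free base point permits.\<close>
      have "(\<Sum>k\<in>?K. ?T k j / b) = (\<Sum>k\<in>(\<lambda>k. k + j) ` ?K.
          (\<integral>y. (cmod (hat_sum (1 / b) f y (of_int k * a)))\<^sup>2 \<partial>lebesgue_on {(of_int (k - j) * a - a / 2)..(of_int (k - j) * a - a / 2) + 1 / b}) / b)"
        by (subst sum.reindex) (auto simp: J_def inj_on_def o_def)
      also have "\<dots> \<le> ?E" by (rule sum_fiber_energy_le[OF b f S]) simp
      finally have "(\<Sum>k\<in>?K. ?T k j) / b \<le> ?E" by (simp only: sum_divide_distrib)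
      then show "(\<Sum>k\<in>?K. ?T k j) \<le> b * ?E" using b by (simp add: pos_divide_le_eq mult.commute)
    qed
    also have "\<dots> = (C * b * real (card {-N..N})) * ?E" by simp
    also have "\<dots> \<le> D * ?E"
      unfolding D_def by (intro mult_right_mono infsum_nonneg) auto
    finally show ?thesis .
  qed
  have "(L2_norm f)\<^sup>2 \<le> D * infsum (gabor_energy a b f) UNIV"
    if f: "f \<in> L2" and S: "gabor_energy a b f summable_on UNIV" for f
  \<comment> \<open>The estimate on \<open>[- n * a, n * a]\<close> is uniform in \<open>n\<close>,
    so dominated convergence passes it to the whole line.\<close>
  proof (rule LIMSEQ_le_const2)
    have fi: "integrable lebesgue (\<lambda>x. (cmod (f x))\<^sup>2)" by (rule L2_D(2)[OF f])
    show "(\<lambda>n. \<integral>x. indicator {- (real n * a)..real n * a} x * (cmod (f x))\<^sup>2 \<partial>lebesgue) \<longlonglongrightarrow> (L2_norm f)\<^sup>2"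
      unfolding L2_norm_sq
    proof (rule integral_dominated_convergence[where w = "\<lambda>x. (cmod (f x))\<^sup>2"])
      show "(\<lambda>x. indicator {- (real n * a)..real n * a} x * (cmod (f x))\<^sup>2) \<in> borel_measurable lebesgue" for n
        using integrable_mult_indicator[OF _ fi, of "{- (real n * a)..real n * a}"]
        by (intro borel_measurable_integrable) simp
      show "AE x in lebesgue. (\<lambda>n. indicator {- (real n * a)..real n * a} x * (cmod (f x))\<^sup>2) \<longlonglongrightarrow> (cmod (f x))\<^sup>2"
      proof (intro AE_I2 tendsto_eventually)
        fix x
        obtain n0 where "\<bar>x\<bar> / a \<le> real n0" using real_arch_simple by blast
        then have n0: "\<bar>x\<bar> \<le> real n0 * a" using a by (simp add: pos_divide_le_eq)
        show "\<forall>\<^sub>F n in sequentially. indicator {- (real n * a)..real n * a} x * (cmod (f x))\<^sup>2 = (cmod (f x))\<^sup>2"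
          using eventually_ge_at_top[of n0]
        proof eventually_elim
          case (elim n)
          then have "real n0 * a \<le> real n * a" using a by (intro mult_right_mono) auto
          then have "x \<in> {- (real n * a)..real n * a}" using n0 by auto
          then show ?case by simp
        qed
      qed
      show "AE x in lebesgue. norm (indicator {- (real n * a)..real n * a} x * (cmod (f x))\<^sup>2) \<le> (cmod (f x))\<^sup>2" for n
        by (intro AE_I2) (simp add: indicator_def)
    qed (use fi in auto)
    show "\<exists>n0. \<forall>n\<ge>n0. (\<integral>x. indicator {- (real n * a)..real n * a} x * (cmod (f x))\<^sup>2 \<partial>lebesgue)
        \<le> D * infsum (gabor_energy a b f) UNIV"
      using fin[OF f S] by blast
  qed
  moreover have "D > 0" using C b unfolding D_def by (intro add_nonneg_pos) auto
  ultimately show ?thesis by blast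
qed

section \<open>From recoverability to the parameter regions\<close>

lemma frame_set_if_recoverable:
  assumes a: "a > 0" and b: "b > 0" and ab: "a \<le> 1 / b" and R: "recoverable (1 / b) a (a / 2)"
  shows "(a, b) \<in> frame_set (\<lambda>x. complex_of_real (B2 x))"
proof -
  obtain B where B: "B > 0" and up: "\<And>f. f \<in> L2 \<Longrightarrow>
      gabor_energy a b f summable_on UNIV \<and> infsum (gabor_energy a b f) UNIV \<le> B * (L2_norm f)\<^sup>2"
    using gabor_upper_bound[OF a b] by blast
  obtain D where D: "D > 0" and lo: "\<And>f. f \<in> L2 \<Longrightarrow> gabor_energy a b f summable_on UNIV \<Longrightarrow>
      (L2_norm f)\<^sup>2 \<le> D * infsum (gabor_energy a b f) UNIV"
    using gabor_lower_bound[OF a b ab R] by blast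
  have lo': "(1 / D) * (L2_norm f)\<^sup>2 \<le> infsum (gabor_energy a b f) UNIV" if "f \<in> L2" for f
    using lo[OF that] up[OF that] D by (simp add: field_simps)
  have "L2_frame (hat_gabor a b)"
    unfolding L2_frame_def
  proof (intro conjI allI exI ballI)
    fix f assume f: "f \<in> L2"
    show "(\<lambda>i. (cmod (L2_inner f (hat_gabor a b i)))\<^sup>2) summable_on UNIV"
      using up[OF f] unfolding gabor_energy_def[abs_def] by blast
    show "1 / D * (L2_norm f)\<^sup>2 \<le> (\<Sum>\<^sub>\<infinity>i. (cmod (L2_inner f (hat_gabor a b i)))\<^sup>2)"
      using lo'[OF f] unfolding gabor_energy_def[abs_def] .
    show "(\<Sum>\<^sub>\<infinity>i. (cmod (L2_inner f (hat_gabor a b i)))\<^sup>2) \<le> B * (L2_norm f)\<^sup>2"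
      using up[OF f] unfolding gabor_energy_def[abs_def] by blast
  qed (use B D hat_gabor_in_L2 in auto)
  then show ?thesis using a b by (simp add: frame_set_def)
qed

lemma frame_set_near:
  assumes "b > 1" "b \<le> 2 / (1 + a)" "2 * (1 - 1 / b) \<le> a" "1 / b - a < 1/2" "a > 0"
  shows "(a, b) \<in> frame_set (\<lambda>x. complex_of_real (B2 x))"
proof -
  have s: "1 + a \<le> 2 * (1 / b)" "1 / b < 1" using assms by (auto simp: field_simps)
  have R: "recoverable (1 / b) a (a / 2)" by (rule recoverable_near[OF s(2) assms(3) s(1) assms(4)])
  have "a \<le> 1 / b" using s by linarith
  then show ?thesis using assms R by (intro frame_set_if_recoverable) auto
qed

lemma Gamma3_subset: "Gamma3 \<subseteq> frame_set (\<lambda>x. complex_of_real (B2 x))"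
proof
  fix p assume "p \<in> Gamma3"
  then obtain a b where p: "p = (a, b)" and ab: "a > 0" "b > 0" "a \<le> 2/9 \<or> 2/7 < a" "a < 1/2"
    "4 / (2 + 3 * a) < b" "b \<le> 2 / (1 + a)"
    by (auto simp: Gamma3_def)
  have s: "1 + a \<le> 2 * (1 / b)" "4 * (1 / b) < 2 + 3 * a"
    using ab by (auto simp: field_simps)
  show "p \<in> frame_set (\<lambda>x. complex_of_real (B2 x))"
  proof (cases "2 * (1 - 1 / b) \<le> a")
    case True
    \<comment> \<open>Both \<open>1 / b < 1\<close> and \<open>1 / b - a < 1/2\<close> follow from
      \<open>4 / b < 2 + 3 * a\<close> with \<open>0 < a < 1/2\<close>.\<close>
    have "1 / b < 1" using s(2) ab by linarith
    then have "b > 1" using ab by (simp add: field_simps)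
    then show ?thesis unfolding p using True ab s by (intro frame_set_near) auto
  next
    case False
    have "recoverable (1 / b) a (a / 2)" by (rule recoverable_far) (use ab s False in auto)
    then show ?thesis unfolding p using ab s by (intro frame_set_if_recoverable) auto
  qed
qed

text \<open>On each of these regions \<open>a \<ge> 1/2\<close> and
  \<open>1 + a \<le> 2 / b\<close>, hence \<open>2 * (1 - 1 / b) \<le> 1 - a \<le> a\<close>, so
  propagation from the first block always applies.\<close>

lemma Lambda_subset:
  assumes "m \<ge> 3"
  shows "Lambda m \<subseteq> frame_set (\<lambda>x. complex_of_real (B2 x))"
proof
  fix p assume "p \<in> Lambda m"
  then obtain a b where p: "p = (a, b)" "(a, b) \<in> Lambda m" by (metis prod.exhaust)
  have "1/2 \<le> a \<and> b > 1 \<and> b \<le> 2 / (1 + a)"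
  proof (cases "m = 3")
    case True
    then have a: "1/2 \<le> a" "b \<le> 6 / (2 + 5 * a)" "b > 1" using p(2) by (auto simp: Lambda_def)
    \<comment> \<open>After clearing denominators this comparison is exactly
      \<open>a \<ge> 1/2\<close>.\<close>
    have "6 / (2 + 5 * a) \<le> 2 / (1 + a)" using a(1) by (simp add: field_simps)
    then show ?thesis using a by simp
  next
    case False
    then have m: "real m \<ge> 4" using assms by simp
    have a: "(real m - 3) / (real m - 2) \<le> a" "b \<le> 2 / (1 + a)" "b > 1" using p(2) False by (auto simp: Lambda_def)
    \<comment> \<open>Equality holds at \<open>m = 4\<close>, the smallest index of this
      case.\<close>
    have "1/2 \<le> (real m - 3) / (real m - 2)" using m by (simp add: field_simps)
    then have "1/2 \<le> a" using a(1) by (rule order_trans)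
    then show ?thesis using a by simp
  qed
  then have ab: "1/2 \<le> a" "b > 1" "b \<le> 2 / (1 + a)" by auto
  define s where "s = 1 / b"
  have "1 + a \<le> 2 * s" "s < 1" using ab by (auto simp: s_def field_simps)
  then have "2 * (1 - s) \<le> a" "s - a < 1/2" using ab(1) by auto
  then show "p \<in> frame_set (\<lambda>x. complex_of_real (B2 x))"
    unfolding p(1) s_def using ab by (intro frame_set_near) auto
qed

theorem theorem1:
  "Gamma3 \<union> (\<Union>m\<in>{3..}. Lambda m) \<subseteq> frame_set (\<lambda>x. complex_of_real (B2 x))"
  using Gamma3_subset Lambda_subset by (simp add: UN_subset_iff)

end
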